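(* Let $G$ be the graph constructed in the context. Then $G$ is cubic, non-traceable (has no Hamiltonian path), star-like, and $3$-connected.
   Context: A graph $H$ is hypohamiltonian if it is not Hamiltonian but $H-v$ is Hamiltonian for every vertex $v$. For each $i\in\{1,2,3\}$ let $H_i$ be a finite simple graph that is $3$-connected, cubic, non-planar and hypohamiltonian. Fix $z_i\in V(H_i)$ with neighbours $n_1,n_2,n_3$, and let $H_i^-=H_i-z_i$. Construct $G_i$ from $H_i$: delete the edges $z_in_1$, $z_in_2$; add new vertices $x_i,y_i$ and edges $n_1x_i$, $x_iz_i$, $n_2y_i$, $y_iz_i$, $x_iy_i$. Replace the three edges of the triangle $x_iy_iz_i$ by paths $x_ir_1g_1y_i$, $y_ir_2g_2z_i$, $z_ir_3g_3x_i$ through new vertices. Add a new vertex $x_i'$ adjacent to $r_1,r_2,r_3$. Add new vertices $y_i'$, $o_1,o_2,o_3$ with edges $y_i'o_j$, $o_jg_j$ ($j=1,2,3$). Add a new vertex $z_i'$ adjacent to $o_1,o_2,o_3$. Let $G_i^-=G_i-z_i'$ and denote $o_1,o_2,o_3$ (in an arbitrary fixed order) by $a_i,b_i,c_i$. The graph $G$ is obtained from the disjoint union of $G_1^-,G_2^-,G_3^-$ and a new vertex $x$ by adding the six edges $xa_1$, $xa_2$, $xa_3$, $b_1c_2$, $b_2c_3$, $b_3c_1$. A connected cubic graph is star-like if it has a perfect matching $M$ such that the graph obtained by contracting each cycle of $G-M$ to a single vertex (two such vertices adjacent when an edge of $M$ joins the corresponding cycles) is a star (a tree of diameter at most $2$).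 *)

theory Defs
  imports "HOL-Analysis.Analysis" "Graph_Theory.Graph_Theory"
begin

text \<open>
  An undirected finite simple graph is a symmetric, loop-free, finite digraph without parallel
  arcs, i.e. an instance of \<^locale>\<open>pair_graph\<close>: each edge \<open>uv\<close> is represented by the two arcs
  \<open>(u, v)\<close> and \<open>(v, u)\<close>, and the degree of a vertex is its out-degree.
\<close>

section \<open>Notions for undirected graphs\<close>

text \<open>
  The library's cycles may have length 2, so in a symmetric digraph every edge, traversed back and
  forth, is one. The bound on the length excludes this. For the same reason the library's \<open>tree\<close>
  is not the right notion for undirected graphs.
\<close>

definition simple_cycle :: "('a, 'b) pre_digraph \<Rightarrow> 'b list \<Rightarrow> bool" where
  "simple_cycle G p \<longleftrightarrow> pre_digraph.cycle G p \<and> 3 \<le> length p"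

definition cycle_verts :: "('a, 'b) pre_digraph \<Rightarrow> 'b list \<Rightarrow> 'a set" where
  "cycle_verts G p = tail G ` set p"

definition hamiltonian :: "('a, 'b) pre_digraph \<Rightarrow> bool" where
  "hamiltonian G \<longleftrightarrow> (\<exists>p. simple_cycle G p \<and> cycle_verts G p = verts G)"

definition hypohamiltonian :: "('a, 'b) pre_digraph \<Rightarrow> bool" where
  "hypohamiltonian G \<longleftrightarrow>
     \<not> hamiltonian G \<and> (\<forall>v\<in>verts G. hamiltonian (pre_digraph.del_vert G v))"

definition traceable :: "('a, 'b) pre_digraph \<Rightarrow> bool" where
  "traceable G \<longleftrightarrow> (\<exists>p. vpath p G \<and> set p = verts G)"

definition k_connected :: "nat \<Rightarrow> ('a, 'b) pre_digraph \<Rightarrow> bool" where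
  "k_connected k G \<longleftrightarrow> k < card (verts G) \<and>
     (\<forall>S \<subseteq> verts G. card S < k \<longrightarrow> Digraph_Component.connected (G \<restriction> (verts G - S)))"

definition diameter :: "('a, 'b) pre_digraph \<Rightarrow> ereal" where
  "diameter G = (SUP u\<in>verts G. SUP v\<in>verts G. wf_digraph.\<mu> G (\<lambda>_. 1) u v)"

definition star :: "('a, 'b) pre_digraph \<Rightarrow> bool" where
  "star G \<longleftrightarrow>
     Digraph_Component.connected G \<and> (\<nexists>p. simple_cycle G p) \<and> diameter G \<le> 2"

definition cubic :: "'a pair_pre_digraph \<Rightarrow> bool" where
  "cubic G \<longleftrightarrow> pair_graph G \<and> (\<forall>v\<in>pverts G. out_degree (with_proj G) v = 3)"

text \<open>
  Planarity is the existence of a drawing in the plane without crossings; the curve of an edge is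
  indexed by the set of its two ends.
\<close>

definition planar :: "'a pair_pre_digraph \<Rightarrow> bool" where
  "planar G \<longleftrightarrow> (\<exists>(pos :: 'a \<Rightarrow> real^2) (crv :: 'a set \<Rightarrow> real \<Rightarrow> real^2).
     inj_on pos (pverts G) \<and>
     (\<forall>(u, v) \<in> parcs G.
        arc (crv {u, v}) \<and>
        {pathstart (crv {u, v}), pathfinish (crv {u, v})} = {pos u, pos v} \<and>
        path_image (crv {u, v}) \<inter> pos ` pverts G = {pos u, pos v}) \<and>
     (\<forall>(u, v) \<in> parcs G. \<forall>(u', v') \<in> parcs G. {u, v} \<noteq> {u', v'} \<longrightarrow>
        path_image (crv {u, v}) \<inter> path_image (crv {u', v'}) \<subseteq> pos ` ({u, v} \<inter> {u', v'})))"

definition perfect_matching :: "'a pair_pre_digraph \<Rightarrow> 'a rel \<Rightarrow> bool" where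
  "perfect_matching G M \<longleftrightarrow> M \<subseteq> parcs G \<and> sym M \<and> (\<forall>v\<in>pverts G. \<exists>!w. (v, w) \<in> M)"

definition delete_edges :: "'a pair_pre_digraph \<Rightarrow> 'a rel \<Rightarrow> 'a pair_pre_digraph" where
  "delete_edges G M = \<lparr>pverts = pverts G, parcs = parcs G - M\<rparr>"

text \<open>
  The cycles of \<open>G - M\<close> are represented by their vertex sets. The contracted graph is simple:
  matching edges inside one cycle are dropped and parallel ones are identified.
\<close>

definition contract_cycles :: "'a pair_pre_digraph \<Rightarrow> 'a rel \<Rightarrow> 'a set pair_pre_digraph" where
  "contract_cycles G M =
    (let F = with_proj (delete_edges G M);
         \<C> = {cycle_verts F p | p. simple_cycle F p}
     in \<lparr>pverts = \<C>,
         parcs = {(C, D). C \<in> \<C> \<and> D \<in> \<C> \<and> C \<noteq> D \<and> (\<exists>u\<in>C. \<exists>v\<in>D. (u, v) \<in> M)}\<rparr>)"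

definition star_like :: "'a pair_pre_digraph \<Rightarrow> bool" where
  "star_like G \<longleftrightarrow> Digraph_Component.connected (with_proj G) \<and> cubic G \<and>
     (\<exists>M. perfect_matching G M \<and> star (with_proj (contract_cycles G M)))"

section \<open>The construction\<close>

text \<open>
  In \<open>part_graph H z n\<close> the vertices \<open>n 1\<close>, \<open>n 2\<close>, \<open>n 3\<close> are meant to be the neighbours of \<open>z\<close>.
  \<open>Orig\<close> tags the vertices of \<open>H\<close> (including \<open>z\<close>, which is kept); the primed constructors
  are \<open>x'\<close>, \<open>y'\<close>, \<open>z'\<close>.
\<close>

datatype 'a part_vertex =
  Orig 'a | Xv | Yv | Rv nat | Gv nat | Ov nat | Xv' | Yv' | Zv'

definition triangle_graph ::
  "'a pair_pre_digraph \<Rightarrow> 'a \<Rightarrow> (nat \<Rightarrow> 'a) \<Rightarrow> 'a part_vertex pair_pre_digraph" where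
  "triangle_graph H z n =
    \<lparr>pverts = Orig ` pverts H \<union> {Xv, Yv},
     parcs = map_prod Orig Orig ` (parcs H - symcl {(z, n 1), (z, n 2)}) \<union>
       symcl {(Orig (n 1), Xv), (Xv, Orig z), (Orig (n 2), Yv), (Yv, Orig z), (Xv, Yv)}\<rparr>"

definition part_graph ::
  "'a pair_pre_digraph \<Rightarrow> 'a \<Rightarrow> (nat \<Rightarrow> 'a) \<Rightarrow> 'a part_vertex pair_pre_digraph" where
  "part_graph H z n =
    \<lparr>pverts = pverts (triangle_graph H z n) \<union>
       Rv ` {1, 2, 3} \<union> Gv ` {1, 2, 3} \<union> Ov ` {1, 2, 3} \<union> {Xv', Yv', Zv'},
     parcs = (parcs (triangle_graph H z n) - symcl {(Xv, Yv), (Yv, Orig z), (Orig z, Xv)}) \<union>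
       symcl ({(Xv, Rv 1), (Rv 1, Gv 1), (Gv 1, Yv),
               (Yv, Rv 2), (Rv 2, Gv 2), (Gv 2, Orig z),
               (Orig z, Rv 3), (Rv 3, Gv 3), (Gv 3, Xv)} \<union>
              (\<Union>j\<in>{1, 2, 3}. {(Xv', Rv j), (Yv', Ov j), (Ov j, Gv j), (Zv', Ov j)}))\<rparr>"

datatype 'b joined_vertex = Hub | Part nat 'b

definition join_parts ::
  "(nat \<Rightarrow> ('b, 'b \<times> 'b) pre_digraph) \<Rightarrow> (nat \<Rightarrow> 'b) \<Rightarrow> (nat \<Rightarrow> 'b) \<Rightarrow> (nat \<Rightarrow> 'b)
    \<Rightarrow> 'b joined_vertex pair_pre_digraph" where
  "join_parts P a b c =
    \<lparr>pverts = insert Hub (\<Union>i\<in>{1, 2, 3}. Part i ` verts (P i)),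
     parcs = (\<Union>i\<in>{1, 2, 3}. map_prod (Part i) (Part i) ` arcs (P i)) \<union>
       symcl {(Hub, Part 1 (a 1)), (Hub, Part 2 (a 2)), (Hub, Part 3 (a 3)),
              (Part 1 (b 1), Part 2 (c 2)), (Part 2 (b 2), Part 3 (c 3)),
              (Part 3 (b 3), Part 1 (c 1))}\<rparr>"

text \<open>
  \<open>\<sigma> i\<close> is the permutation of \<open>{1, 2, 3}\<close> that records which of the \<open>o\<^sub>j\<close> in the \<open>i\<close>-th part are
  named \<open>a\<close>, \<open>b\<close> and \<open>c\<close>.
\<close>

definition construction ::
  "(nat \<Rightarrow> 'a pair_pre_digraph) \<Rightarrow> (nat \<Rightarrow> 'a) \<Rightarrow> (nat \<Rightarrow> nat \<Rightarrow> 'a) \<Rightarrow> (nat \<Rightarrow> nat \<Rightarrow> nat)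
    \<Rightarrow> 'a part_vertex joined_vertex pair_pre_digraph" where
  "construction H z n \<sigma> =
    join_parts
      (\<lambda>i. pre_digraph.del_vert (with_proj (part_graph (H i) (z i) (n i))) Zv')
      (\<lambda>i. Ov (\<sigma> i 1)) (\<lambda>i. Ov (\<sigma> i 2)) (\<lambda>i. Ov (\<sigma> i 3))"

end

theory Submission
  imports Defs
begin

text \<open>
  Each copy of \<open>H\<^sub>i - z\<^sub>i\<close> hangs on the rest of \<open>G\<close> by three pairwise disjoint edges. A Hamiltonian path
  of \<open>G\<close> with no end in that copy therefore traverses it in one piece, from one neighbour of \<open>z\<^sub>i\<close> to
  another, and adding \<open>z\<^sub>i\<close> gives a Hamiltonian cycle of \<open>H\<^sub>i\<close>. So each of the three disjoint copies
  would contain an end of the path, which has only two.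

  The graph \<open>G\<close> arises from \<open>K\<^sub>4\<close> by repeatedly replacing a cubic vertex with a 3-connected cubic
  graph minus a vertex, which preserves 3-connectivity. The factors are the \<open>H\<^sub>i\<close> and a graph on 16
  vertices for which 3-connectivity is computed.

  For star-likeness, take Hamiltonian cycles of the \<open>H\<^sub>i - z\<^sub>i\<close> as leaves. The remaining
  vertices lie on one cycle, the centre: for any two of the vertices \<open>o\<^sub>j\<close>, what is left of a part has a
  Hamiltonian path joining them.
\<close>

section \<open>3-connected graphs\<close>

text \<open>A cut of three disjoint edges allows only one passage of a path with both ends outside:
  entry and exit use different edges, so two passages would need four. Such cuts also organise
  connectivity. Inspecting \<open>G\<close> directly would mean distinguishing all positions of two
  deleted vertices. Splicing confines this to one argument about a single cut: either one side loses
  nothing, or each side loses one vertex and some cut edge survives. Every part contains two such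
  cuts, around the copy of H_i - z_i and around \<open>Zv'\<close>. The 16-vertex factor is the
  piece between them, closed on one side by \<open>Zv'\<close> and on the other by a new vertex in
  place of the copy. It does not depend on H_i, so evaluation can settle it. Star-likeness rests on
  a degree count: disjoint cycles covering a cubic graph use two of the three edges at each vertex,
  so the other edges form a perfect matching. What needs care is that contraction sees these cycles
  and no others.\<close>

lemma symcl_insert [simp]: "symcl (insert (a, b) R) = insert (a, b) (insert (b, a) (symcl R))"
  and symcl_empty [simp]: "symcl {} = {}"
  by (auto simp: symcl_def)

lemma sym_symcl: "sym (symcl R)"
  by (auto simp: symcl_def sym_def)

lemma sym_map_prod_image:
  assumes "sym R"
  shows "sym (map_prod f f ` R)"
proof (rule symI)
  fix a b assume "(a, b) \<in> map_prod f f ` R"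
  then obtain x y where "(x, y) \<in> R" "a = f x" "b = f y" by auto
  then have "(y, x) \<in> R" "map_prod f f (y, x) = (b, a)" using symD[OF assms] by auto
  then show "(b, a) \<in> map_prod f f ` R" by (metis imageI)
qed

text \<open>The empty set counts as linked, unlike connectedness in the library; this spares side
  conditions when a deletion removes everything. Arcs of \<open>E\<close> leaving \<open>W\<close>
  are ignored by \<open>rtrancl_on\<close>, so one arc set can serve many vertex sets.\<close>

definition linked :: "'v set \<Rightarrow> 'v rel \<Rightarrow> bool" where
  "linked W E \<longleftrightarrow> (\<forall>u\<in>W. \<forall>v\<in>W. (u, v) \<in> rtrancl_on W E)"

definition tri_connected :: "'v set \<Rightarrow> 'v rel \<Rightarrow> bool" where
  "tri_connected V E \<longleftrightarrow> (\<forall>S. finite S \<longrightarrow> card S < 3 \<longrightarrow> linked (V - S) E)"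

text \<open>
  A fragment is what remains of a 3-connected graph when a vertex with neighbourhood \<open>T\<close> is deleted.
\<close>

definition fragment :: "'v set \<Rightarrow> 'v rel \<Rightarrow> 'v set \<Rightarrow> bool" where
  "fragment F E T \<longleftrightarrow>
     (\<forall>S. finite S \<longrightarrow> card S < 2 \<longrightarrow> linked (F - S) E) \<and>
     (\<forall>S. finite S \<longrightarrow> card S < 3 \<longrightarrow> (\<forall>v\<in>F - S. \<exists>t\<in>T. (v, t) \<in> rtrancl_on (F - S) E))"

lemma rtrancl_on_map_prod:
  assumes "(u, v) \<in> rtrancl_on W E"
  shows "(f u, f v) \<in> rtrancl_on (f ` W) (map_prod f f ` E)"
  using assms
proof (induction rule: rtrancl_on_induct)
  case (step y z)
  then have "(f y, f z) \<in> map_prod f f ` E" by force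
  with step show ?case by (blast intro: rtrancl_on_into_rtrancl_on)
qed auto

lemma tri_connected_image:
  fixes f :: "'v \<Rightarrow> 'w"
  assumes "tri_connected V E" and "inj_on f V" and "finite V"
  shows "tri_connected (f ` V) (map_prod f f ` E)"
  unfolding tri_connected_def
proof (intro allI impI)
  fix S :: "'w set" assume S: "finite S" "card S < 3"
  define S' where "S' = {v \<in> V. f v \<in> S}"
  have "card S' \<le> card S"
    by (rule card_inj_on_le[of f]) (use assms(2) S in \<open>auto simp: S'_def inj_on_def\<close>)
  moreover have "finite S'" using assms(3) by (auto simp: S'_def)
  ultimately have "linked (V - S') E"
    using assms(1) S by (auto simp: tri_connected_def)
  moreover have "f ` V - S = f ` (V - S')" by (auto simp: S'_def)
  ultimately show "linked (f ` V - S) (map_prod f f ` E)"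
    unfolding linked_def by (auto intro: rtrancl_on_map_prod)
qed

lemma rtrancl_on_mono_arcs:
  assumes "(u, v) \<in> rtrancl_on W E" and "W \<subseteq> W'" and "Restr E W \<subseteq> E'"
  shows "(u, v) \<in> rtrancl_on W' E'"
  using assms(1)
proof (induction rule: rtrancl_on_induct)
  case (step y z)
  then have "(y, z) \<in> E'" using assms(3) by blast
  with step assms(2) show ?case by (blast intro: rtrancl_on_into_rtrancl_on)
qed (use assms(2) in auto)

text \<open>Stop a walk to \<open>u\<close> at its first arrival: the vertex just before is the
  required \<open>t\<close>.\<close>

lemma rtrancl_on_via_neighbour:
  assumes "(v, u) \<in> rtrancl_on W E" and "v \<noteq> u"
  shows "\<exists>t\<in>W - {u}. (t, u) \<in> E \<and> (v, t) \<in> rtrancl_on (W - {u}) E"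
  using assms
proof (induction rule: converse_rtrancl_on_induct)
  case (step y z)
  show ?case
  proof (cases "z = u")
    case False
    with step obtain t where t: "t \<in> W - {u}" "(t, u) \<in> E" "(z, t) \<in> rtrancl_on (W - {u}) E"
      by blast
    then have "(y, t) \<in> rtrancl_on (W - {u}) E"
      using step by (intro converse_rtrancl_on_into_rtrancl_on[of y z]) auto
    with t show ?thesis by blast
  qed (use step in auto)
qed auto

text \<open>Removing \<open>u\<close> uses up one of the two deletions that 3-connectedness
  tolerates, which leaves one for the first clause. For the second clause \<open>u\<close> is put
  back: a walk to \<open>u\<close> avoiding \<open>S\<close> meets a neighbour of \<open>u\<close>
  just before its end.\<close>

lemma fragment_remove:
  assumes "tri_connected V E" and "sym E" and "u \<in> V" and "E `` {u} \<inter> V \<subseteq> T"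
  shows "fragment (V - {u}) E T"
  unfolding fragment_def
proof (intro conjI allI impI ballI)
  fix S :: "'a set" assume S: "finite S" "card S < 2"
  have "card (insert u S) < 3" using S by (simp add: card_insert_if)
  then have "linked (V - insert u S) E"
    using assms(1) S by (auto simp: tri_connected_def)
  moreover have "V - insert u S = V - {u} - S" by auto
  ultimately show "linked (V - {u} - S) E" by simp
next
  fix S v assume S: "finite S" "card S < 3" and v: "v \<in> V - {u} - S"
  have "card (S - {u}) < 3" using S card_Diff1_le[of S u] by linarith
  then have "linked (V - (S - {u})) E"
    using assms(1) S by (simp add: tri_connected_def)
  then have "(v, u) \<in> rtrancl_on (V - (S - {u})) E"
    using v assms(3) by (auto simp: linked_def)
  then obtain t where t: "t \<in> V - (S - {u}) - {u}" "(t, u) \<in> E"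
      "(v, t) \<in> rtrancl_on (V - (S - {u}) - {u}) E"
    using rtrancl_on_via_neighbour[of v u] v by auto
  moreover have "V - (S - {u}) - {u} = V - {u} - S" by auto
  moreover have "t \<in> T" using t assms(2,4) by (auto dest: symD)
  ultimately show "\<exists>t\<in>T. (v, t) \<in> rtrancl_on (V - {u} - S) E" by auto
qed

lemma fragment_mono:
  assumes "fragment F E T" and "Restr E F \<subseteq> E'"
  shows "fragment F E' T"
proof -
  have "(u, v) \<in> rtrancl_on (F - S) E'" if "(u, v) \<in> rtrancl_on (F - S) E" for u v S
    using rtrancl_on_mono_arcs[OF that, of "F - S" E'] assms(2) by blast
  then show ?thesis using assms(1) unfolding fragment_def linked_def by meson
qed

section \<open>Gluing two fragments along three disjoint edges\<close>

lemma linked_Un: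
  assumes sym: "sym E" and "linked F E"
    and R: "\<And>v. v \<in> R \<Longrightarrow> \<exists>t\<in>F. (v, t) \<in> rtrancl_on (F \<union> R) E"
  shows "linked (F \<union> R) E"
proof -
  have *: "\<exists>t\<in>F. (v, t) \<in> rtrancl_on (F \<union> R) E" if "v \<in> F \<union> R" for v
    using that R by auto
  have sym': "sym (rtrancl_on (F \<union> R) E)"
    using sym by (rule rtrancl_on_sym)
  show ?thesis unfolding linked_def
  proof (intro ballI)
    fix u v assume "u \<in> F \<union> R" "v \<in> F \<union> R"
    then obtain s t where st: "s \<in> F" "t \<in> F"
      "(u, s) \<in> rtrancl_on (F \<union> R) E" "(v, t) \<in> rtrancl_on (F \<union> R) E"
      using * by meson
    have "(s, t) \<in> rtrancl_on (F \<union> R) E"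
      using assms(2) st(1,2) rtrancl_on_mono_arcs[of s t F E "F \<union> R" E] by (auto simp: linked_def)
    then show "(u, v) \<in> rtrancl_on (F \<union> R) E"
      using st sym' by (meson rtrancl_on_trans symD)
  qed
qed

text \<open>The case of an intact side \<open>R\<close>: it stays linked, and every surviving vertex
  of \<open>F\<close> reaches a surviving end of a cut edge, whose other end lies in
  \<open>R\<close>.\<close>

lemma tri_connected_glue_aux:
  assumes F: "fragment F E T" and R: "fragment R E (m ` T)"
    and sub: "T \<subseteq> F" "m ` T \<subseteq> R"
    and m: "\<And>t. t \<in> T \<Longrightarrow> (t, m t) \<in> E" and sym: "sym E"
    and S: "finite S" "card S < 3" "card (S \<inter> R) = 0"
  shows "linked (F \<union> R - S) E"
proof -
  have SR: "S \<inter> R = {}" using S by auto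
  have "linked (R - S') E" if "finite S'" "card S' < 2" for S'
    using R that by (simp add: fragment_def)
  from this[of "{}"] have lR: "linked R E" by simp
  have "linked (R \<union> (F - S)) E"
  proof (rule linked_Un[OF sym lR])
    fix v assume v: "v \<in> F - S"
    then obtain t where t: "t \<in> T" "(v, t) \<in> rtrancl_on (F - S) E"
      using F S unfolding fragment_def by meson
    have "(v, t) \<in> rtrancl_on (R \<union> (F - S)) E"
      using rtrancl_on_mono_arcs[OF t(2)] by auto
    moreover have mR: "m t \<in> R" using sub(2) t(1) by blast
    ultimately have "(v, m t) \<in> rtrancl_on (R \<union> (F - S)) E"
      by (blast intro: rtrancl_on_into_rtrancl_on m[OF t(1)])
    then show "\<exists>t\<in>R. (v, t) \<in> rtrancl_on (R \<union> (F - S)) E" using mR by blast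
  qed
  moreover have "F \<union> R - S = R \<union> (F - S)" using SR by auto
  ultimately show ?thesis by simp
qed

text \<open>At most two vertices are deleted. Either one side is untouched, or each side loses
  exactly one vertex and remains linked, and a surviving cut edge joins the two sides.\<close>

lemma tri_connected_glue:
  assumes F: "fragment F E T" and R: "fragment R E (m ` T)"
    and disj: "F \<inter> R = {}" and sub: "T \<subseteq> F" "m ` T \<subseteq> R"
    and m: "\<And>t. t \<in> T \<Longrightarrow> (t, m t) \<in> E" and inj: "inj_on m T" and T: "card T = 3"
    and sym: "sym E"
  shows "tri_connected (F \<union> R) E"
  unfolding tri_connected_def
proof (intro allI impI)
  fix S :: "'a set" assume S: "finite S" "card S < 3"
  have split: "card (S \<inter> F) + card (S \<inter> R) \<le> card S"
  proof -
    have "card (S \<inter> F) + card (S \<inter> R) = card ((S \<inter> F) \<union> (S \<inter> R))"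
      using S disj by (intro card_Un_disjoint[symmetric]) auto
    also have "\<dots> \<le> card S" using S by (intro card_mono) auto
    finally show ?thesis .
  qed
  then consider "card (S \<inter> R) = 0" | "card (S \<inter> F) = 0" | "card (S \<inter> F) = 1" "card (S \<inter> R) = 1"
    using S by linarith
  then show "linked (F \<union> R - S) E"
  proof cases
    case 1
    then show ?thesis using tri_connected_glue_aux[OF F R sub m sym S] by simp
  next
    case 2
    \<comment> \<open>The same argument with the sides exchanged needs the cut edges read in the
      other direction.\<close>
    define m' where "m' = the_inv_into T m"
    have img: "m' ` m ` T = T" using inj by (force simp: m'_def the_inv_into_f_f)
    have m': "(r, m' r) \<in> E" if "r \<in> m ` T" for r
      using that m symD[OF sym] inj by (auto simp: m'_def the_inv_into_f_f)
    have "linked (R \<union> F - S) E"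
      by (rule tri_connected_glue_aux[OF R, where m = m']) (use 2 F sub m' sym S img in auto)
    then show ?thesis by (simp add: Un_commute)
  next
    case 3
    have lF: "linked (F - S) E"
    proof -
      have "linked (F - (S \<inter> F)) E" using F S 3 unfolding fragment_def by simp
      then show ?thesis by (simp add: Diff_Int_distrib Diff_Int)
    qed
    have lR: "linked (R - S) E"
    proof -
      have "linked (R - (S \<inter> R)) E" using R S 3 unfolding fragment_def by simp
      then show ?thesis by (simp add: Diff_Int_distrib Diff_Int)
    qed
    obtain s s' where s: "S \<inter> F = {s}" "S \<inter> R = {s'}"
      using 3 by (meson card_1_singletonE)
    \<comment> \<open>Each of the two deleted vertices lies on at most one of the three disjoint cut
      edges.\<close>
    have "\<exists>t\<in>T. t \<noteq> s \<and> m t \<noteq> s'"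
    proof (rule ccontr)
      assume "\<not> ?thesis"
      then have "T \<subseteq> {s} \<union> {t \<in> T. m t = s'}" by auto
      moreover have fin: "finite {t \<in> T. m t = s'}" using T by (simp add: card_ge_0_finite)
      ultimately have "card T \<le> card ({s} \<union> {t \<in> T. m t = s'})" by (intro card_mono) auto
      also have "\<dots> \<le> card {s} + card {t \<in> T. m t = s'}" by (rule card_Un_le)
      also have "card {t \<in> T. m t = s'} \<le> 1"
        using inj fin by (auto simp: card_le_Suc0_iff_eq inj_on_def)
      finally show False using T by simp
    qed
    then obtain t where t: "t \<in> T" "t \<in> F - S" "m t \<in> R - S"
      using s sub by blast
    have "linked (F - S \<union> (R - S)) E"
    proof (rule linked_Un[OF sym lF])
      fix v assume "v \<in> R - S"
      then have "(v, m t) \<in> rtrancl_on (R - S) E" using lR t by (auto simp: linked_def)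
      then have "(v, m t) \<in> rtrancl_on (F - S \<union> (R - S)) E"
        by (rule rtrancl_on_mono_arcs) auto
      then have "(v, t) \<in> rtrancl_on (F - S \<union> (R - S)) E"
        by (rule rtrancl_on_into_rtrancl_on[OF _ symD[OF sym m[OF t(1)]]]) (use t in simp)
      then show "\<exists>t\<in>F - S. (v, t) \<in> rtrancl_on (F - S \<union> (R - S)) E" using t by auto
    qed
    moreover have "F \<union> R - S = F - S \<union> (R - S)" by auto
    ultimately show ?thesis by simp
  qed
qed

text \<open>The vertex \<open>u\<close> is replaced with the graph on \<open>W\<close> minus
  \<open>w\<close>, the neighbour \<open>t j\<close> of \<open>u\<close> being joined to the
  neighbour \<open>r j\<close> of \<open>w\<close>. The arc set \<open>E\<close> is only bounded
  from below, so the final graph can be inserted for it without computing the spliced one.\<close>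

lemma tri_connected_splice:
  fixes t r :: "nat \<Rightarrow> 'v"
  assumes V: "tri_connected V E1" "sym E1" "u \<in> V" "E1 `` {u} \<inter> V \<subseteq> {t 1, t 2, t 3}"
    and W: "tri_connected W E2" "sym E2" "w \<in> W" "E2 `` {w} \<inter> W \<subseteq> {r 1, r 2, r 3}"
    and disj: "(V - {u}) \<inter> (W - {w}) = {}"
    and t: "inj_on t {1, 2, 3}" "t ` {1, 2, 3} \<subseteq> V - {u}"
    and r: "inj_on r {1, 2, 3}" "r ` {1, 2, 3} \<subseteq> W - {w}"
    and E: "sym E" "Restr E1 (V - {u}) \<subseteq> E" "Restr E2 (W - {w}) \<subseteq> E"
      "\<And>j. j \<in> {1, 2, 3} \<Longrightarrow> (t j, r j) \<in> E"
  shows "tri_connected ((V - {u}) \<union> (W - {w})) E"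
proof -
  \<comment> \<open>The pairing by indices is turned into a map on vertices, the form that gluing
    expects.\<close>
  define m where "m = r \<circ> the_inv_into {1, 2, 3} t"
  have mt: "m (t j) = r j" if "j \<in> {1, 2, 3}" for j
    using the_inv_into_f_f[OF t(1) that] by (simp add: m_def)
  have img: "m ` t ` {1, 2, 3} = r ` {1, 2, 3}" using mt by auto
  show ?thesis
  proof (rule tri_connected_glue[where T = "t ` {1, 2, 3}" and m = m])
    show "fragment (V - {u}) E (t ` {1, 2, 3})"
      by (rule fragment_mono[OF fragment_remove[OF V(1-3)] E(2)]) (use V(4) in auto)
    have "fragment (W - {w}) E (r ` {1, 2, 3})"
      by (rule fragment_mono[OF fragment_remove[OF W(1-3)] E(3)]) (use W(4) in auto)
    then show "fragment (W - {w}) E (m ` t ` {1, 2, 3})" unfolding img .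
    show "inj_on m (t ` {1, 2, 3})"
    proof (rule inj_on_imageI)
      have "inj_on (m \<circ> t) {1, 2, 3} \<longleftrightarrow> inj_on r {1, 2, 3}"
        by (rule inj_on_cong) (use mt in \<open>simp only: comp_apply\<close>)
      then show "inj_on (m \<circ> t) {1, 2, 3}" using r(1) by simp
    qed
    show "card (t ` {1, 2, 3}) = 3" using card_image[OF t(1)] by simp
    show "(s, m s) \<in> E" if "s \<in> t ` {1, 2, 3}" for s
      using that mt E(4) by auto
    show "m ` t ` {1, 2, 3} \<subseteq> W - {w}" unfolding img by (rule r(2))
  qed (rule disj t(2) E(1))+
qed

section \<open>Agreement with \<open>k_connected\<close>\<close>

lemma k_connected_3_iff:
  assumes "finite (pverts G)" and "sym (parcs G)"
  shows "k_connected 3 (with_proj G) \<longleftrightarrow> 3 < card (pverts G) \<and> tri_connected (pverts G) (parcs G)"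
proof -
  have conn: "Digraph_Component.connected (with_proj G \<restriction> W) \<longleftrightarrow> W \<noteq> {} \<and> linked W (parcs G)"
    if "W \<subseteq> pverts G" for W
  proof -
    let ?E' = "parcs (mk_symmetric (with_proj G \<restriction> W))"
    have "?E' = Restr (parcs G) W"
      using assms(2) by (auto simp: mk_symmetric_def dest: symD)
    moreover have "(u, v) \<in> rtrancl_on W (Restr (parcs G) W) \<longleftrightarrow> (u, v) \<in> rtrancl_on W (parcs G)" for u v
      by (auto elim!: rtrancl_on_mono_arcs)
    ultimately show ?thesis
      by (simp add: connected_def strongly_connected_def linked_def reachable_def mk_symmetric_def)
  qed
  show ?thesis
  proof
    assume k: "k_connected 3 (with_proj G)"
    show "3 < card (pverts G) \<and> tri_connected (pverts G) (parcs G)"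
      unfolding tri_connected_def
    proof (intro conjI allI impI)
      fix S :: "'a set" assume S: "finite S" "card S < 3"
      have "card (S \<inter> pverts G) < 3" using S card_mono[of S "S \<inter> pverts G"] by fastforce
      then have "linked (pverts G - (S \<inter> pverts G)) (parcs G)"
        using k by (simp add: k_connected_def conn)
      then show "linked (pverts G - S) (parcs G)" by (simp add: Diff_Int)
    qed (use k in \<open>simp add: k_connected_def\<close>)
  next
    assume r: "3 < card (pverts G) \<and> tri_connected (pverts G) (parcs G)"
    show "k_connected 3 (with_proj G)"
      unfolding k_connected_def
    proof (intro conjI allI impI)
      fix S assume S: "S \<subseteq> verts (with_proj G)" "card S < 3"
      then have "finite S" using assms(1) finite_subset by auto
      \<comment> \<open>Here the bound on the order is used: library connectedness, unlike
        \<open>linked\<close>, excludes the empty graph.\<close>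
      moreover have "pverts G - S \<noteq> {}"
        using r S card_mono[OF \<open>finite S\<close>, of "pverts G"] by auto
      ultimately show "Digraph_Component.connected (with_proj G \<restriction> (verts (with_proj G) - S))"
        using r S conn[of "pverts G - S"] by (simp add: tri_connected_def)
    qed (use r in simp)
  qed
qed

lemma connected_if_k_connected:
  assumes "pair_graph G" and "k_connected 3 (with_proj G)"
  shows "Digraph_Component.connected (with_proj G)"
proof -
  interpret pair_graph G by fact
  have "with_proj G \<restriction> pverts G = with_proj G"
    by (auto simp: induce_subgraph_def with_proj_def dest: in_arcsD1 in_arcsD2)
  moreover have "Digraph_Component.connected (with_proj G \<restriction> (verts (with_proj G) - {}))"
    using assms(2) unfolding k_connected_def by (metis card.empty empty_subsetI zero_less_numeral)
  ultimately show ?thesis by simp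
qed

text \<open>
  Breadth-first search: \<open>R\<close> is the current layer, \<open>W\<close> the list of vertices not yet reached, and
  the number bounds the remaining rounds.
\<close>

fun explore :: "('v \<Rightarrow> 'v list) \<Rightarrow> nat \<Rightarrow> 'v list \<Rightarrow> 'v list \<Rightarrow> bool" where
  "explore nb 0 R W \<longleftrightarrow> W = []"
| "explore nb (Suc k) R W \<longleftrightarrow> W = [] \<or>
     (let N = concat (map nb R) in
       explore nb k (filter (\<lambda>w. w \<in> set N) W) (filter (\<lambda>w. w \<notin> set N) W))"

text \<open>\<open>length vs\<close> rounds are enough for a connected remainder, because every
  round before the last reaches a new vertex.\<close>

definition connected_without :: "('v \<Rightarrow> 'v list) \<Rightarrow> 'v list \<Rightarrow> 'v list \<Rightarrow> bool" where
  "connected_without nb vs S \<longleftrightarrow>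
     (case filter (\<lambda>v. v \<notin> set S) vs of [] \<Rightarrow> True | v # ws \<Rightarrow> explore nb (length vs) [v] ws)"

text \<open>Invariant: the current layer is reachable from \<open>v\<close> inside \<open>X\<close>.
  Each new layer is selected from \<open>W\<close>, so it stays in \<open>X\<close> although the
  neighbour lists also mention deleted vertices.\<close>

lemma explore_sound:
  assumes "explore nb k R W" and "set W \<subseteq> X" "X \<subseteq> V" and "\<And>r. r \<in> set R \<Longrightarrow> (v, r) \<in> rtrancl_on X E"
    and nb: "\<And>u w. u \<in> V \<Longrightarrow> w \<in> set (nb u) \<Longrightarrow> (u, w) \<in> E"
  shows "\<forall>w\<in>set W. (v, w) \<in> rtrancl_on X E"
  using assms(1,2,4)
proof (induction k arbitrary: R W)
  case (Suc k)
  show ?case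
  proof (cases "W = []")
    case False
    let ?N = "concat (map nb R)"
    let ?R = "filter (\<lambda>w. w \<in> set ?N) W" and ?W = "filter (\<lambda>w. w \<notin> set ?N) W"
    have e: "explore nb k ?R ?W" using Suc.prems(1) False by (simp add: Let_def)
    have r: "(v, r) \<in> rtrancl_on X E" if "r \<in> set ?R" for r
    proof -
      from that obtain u where "u \<in> set R" "r \<in> set (nb u)" "r \<in> X"
        using Suc.prems(2) by auto
      moreover have "u \<in> V"
        using Suc.prems(3)[OF \<open>u \<in> set R\<close>] assms(3) in_rtrancl_on_in_F by fast
      ultimately show ?thesis
        using Suc.prems(3) nb by (blast intro: rtrancl_on_into_rtrancl_on)
    qed
    have "\<forall>w\<in>set ?W. (v, w) \<in> rtrancl_on X E"
      by (rule Suc.IH[OF e _ r]) (use Suc.prems(2) in auto)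
    with r show ?thesis by fastforce
  qed simp
qed simp

lemma connected_without_sound:
  assumes "connected_without nb vs S" and "sym E"
    and nb: "\<And>u w. u \<in> set vs \<Longrightarrow> w \<in> set (nb u) \<Longrightarrow> (u, w) \<in> E"
  shows "linked (set vs - set S) E"
proof (cases "filter (\<lambda>v. v \<notin> set S) vs")
  case Nil
  then have "set vs - set S = {}" by (auto simp: filter_empty_conv)
  then show ?thesis unfolding linked_def by blast
next
  case (Cons v ws)
  have "set (v # ws) = set vs - set S" unfolding Cons[symmetric] by auto
  then have set: "set vs - set S = {v} \<union> set ws" by auto
  then have sub: "{v} \<union> set ws \<subseteq> set vs" by auto
  have ex: "explore nb (length vs) [v] ws"
    using assms(1) Cons by (simp add: connected_without_def)
  have *: "\<forall>w\<in>set ws. (v, w) \<in> rtrancl_on ({v} \<union> set ws) E"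
    by (rule explore_sound[OF ex _ sub _ nb]) auto
  have "linked ({v} \<union> set ws) E"
  proof (rule linked_Un[OF assms(2)])
    show "\<exists>t\<in>{v}. (w, t) \<in> rtrancl_on ({v} \<union> set ws) E" if "w \<in> set ws" for w
      using * that assms(2) by (metis rtrancl_on_sym singletonI symD)
  qed (auto simp: linked_def)
  then show ?thesis unfolding set .
qed

lemma tri_connected_by_search:
  assumes "connected_without nb vs []"
    and pairs: "\<forall>s\<in>set vs. \<forall>t\<in>set vs. connected_without nb vs [s, t]"
    and "sym E" and "\<And>u w. u \<in> set vs \<Longrightarrow> w \<in> set (nb u) \<Longrightarrow> (u, w) \<in> E"
  shows "tri_connected (set vs) E"
  unfolding tri_connected_def
proof (intro allI impI)
  fix S :: "'a set" assume S: "finite S" "card S < 3"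
  let ?S = "S \<inter> set vs"
  have "card ?S < 3" using S card_mono[of S ?S] by fastforce
  then consider "card ?S = 0" | "card ?S = 1" | "card ?S = 2" by linarith
  then have "\<exists>xs. set xs = ?S \<and> connected_without nb vs xs"
  proof cases
    case 1
    then have "set [] = ?S" using S by auto
    with assms(1) show ?thesis by blast
  next
    case 2
    then obtain s where s: "?S = {s}" by (auto simp: card_1_singleton_iff)
    moreover have "s \<in> set vs" using s by blast
    \<comment> \<open>Single deletions are the pairs on the diagonal.\<close>
    ultimately have "set [s, s] = ?S \<and> connected_without nb vs [s, s]" using pairs by auto
    then show ?thesis by blast
  next
    case 3
    then obtain s t where st: "?S = {s, t}" by (auto simp: card_2_iff)
    moreover have "s \<in> set vs" "t \<in> set vs" using st by blast+
    ultimately have "set [s, t] = ?S \<and> connected_without nb vs [s, t]" using pairs by auto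
    then show ?thesis by blast
  qed
  then obtain xs where "set xs = ?S" "connected_without nb vs xs" by blast
  then have "linked (set vs - ?S) E"
    using connected_without_sound assms(3,4) by metis
  then show "linked (set vs - S) E" by (simp add: Diff_Int)
qed

section \<open>Cycles as vertex lists\<close>

text \<open>Zipping a list with its rotation yields the arcs of the closed walk, including the one
  from the last vertex back to the first. Vertex lists are easier to map and concatenate than the
  arc lists of the library.\<close>

definition cyclic :: "'v rel \<Rightarrow> 'v list \<Rightarrow> bool" where
  "cyclic E vs \<longleftrightarrow> distinct vs \<and> 3 \<le> length vs \<and> set (zip vs (rotate1 vs)) \<subseteq> E"

lemma set_zip_shift_subset_iff:
  "vs \<noteq> [] \<Longrightarrow> set (zip vs (tl vs @ [x])) \<subseteq> E \<longleftrightarrow> successively (\<lambda>u v. (u, v) \<in> E) (vs @ [x])"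
proof (induction vs)
  case (Cons v vs)
  then show ?case by (cases vs) auto
qed simp

lemma cyclic_iff_successively:
  "cyclic E vs \<longleftrightarrow>
     distinct vs \<and> 3 \<le> length vs \<and> successively (\<lambda>u v. (u, v) \<in> E) (vs @ [hd vs])"
proof (cases "vs = []")
  case False
  then show ?thesis
    by (simp add: cyclic_def rotate1_hd_tl set_zip_shift_subset_iff)
qed (simp add: cyclic_def)

lemma map_fst_of_cas:
  assumes "pre_digraph.cas F u p v" and "tail F = fst" "head F = snd" and "p \<noteq> []"
  shows "map fst p @ [v] = u # map snd p"
  using assms(1,4)
proof (induction p arbitrary: u)
  case (Cons e p)
  then show ?case using assms(2,3) by (cases p) (auto simp: pre_digraph.cas.simps)
qed simp

lemma cas_zip_shift:
  assumes "tail F = fst" "head F = snd"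
  shows "vs \<noteq> [] \<Longrightarrow> pre_digraph.cas F (hd vs) (zip vs (tl vs @ [x])) x"
proof (induction vs)
  case (Cons v vs)
  then show ?case using assms by (cases vs) (auto simp: pre_digraph.cas.simps)
qed simp

text \<open>The vertex list of a cycle consists of the tails of its arcs, which is also how
  \<open>cycle_verts\<close> reads it.\<close>

lemma ex_simple_cycle_iff:
  assumes "wf_digraph F" and F: "tail F = fst" "head F = snd"
  shows "(\<exists>p. simple_cycle F p \<and> cycle_verts F p = X) \<longleftrightarrow> (\<exists>vs. cyclic (arcs F) vs \<and> set vs = X)"
proof
  interpret wf_digraph F by fact
  {
    assume "\<exists>p. simple_cycle F p \<and> cycle_verts F p = X"
    then obtain p u where p: "awalk u p u" "distinct (tl (awalk_verts u p))" "3 \<le> length p"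
      "X = fst ` set p"
      by (auto simp: simple_cycle_def cycle_verts_def cycle_def F)
    then have ne: "p \<noteq> []" and cas: "cas u p u" by auto
    have shift: "map fst p @ [u] = u # map snd p"
      using map_fst_of_cas[OF cas F ne] .
    have "distinct (map snd p)"
      using p(2) awalk_verts_conv'[OF cas] ne F by simp
    \<comment> \<open>The library demands distinct heads; on a closed walk the tails are the same
      vertices, shifted by one place.\<close>
    moreover have "mset (map fst p) = mset (map snd p)"
      using arg_cong[OF shift, of mset] by simp
    ultimately have dist: "distinct (map fst p)" using mset_eq_imp_distinct_iff by blast
    have "rotate1 (map fst p) = map snd p"
      using shift ne by (cases p) auto
    then have "zip (map fst p) (rotate1 (map fst p)) = p" by (simp add: zip_map_fst_snd)
    then have "cyclic (arcs F) (map fst p)"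
      using p dist by (auto simp: cyclic_def)
    then show "\<exists>vs. cyclic (arcs F) vs \<and> set vs = X" using p(4) by (metis set_map)
  next
    assume "\<exists>vs. cyclic (arcs F) vs \<and> set vs = X"
    then obtain vs where vs: "cyclic (arcs F) vs" "set vs = X" by blast
    then have ne: "vs \<noteq> []" by (auto simp: cyclic_def)
    define p where "p = zip vs (tl vs @ [hd vs])"
    have len: "length (tl vs @ [hd vs]) = length vs" using ne by simp
    have ps: "set p \<subseteq> arcs F" "length p = length vs"
      using vs ne by (auto simp: cyclic_def p_def rotate1_hd_tl)
    have pne: "p \<noteq> []" using ps ne by auto
    have fst: "map fst p = vs" and snd: "map snd p = tl vs @ [hd vs]"
      using len by (simp_all add: p_def)
    have cas: "cas (hd vs) p (hd vs)"
      unfolding p_def by (rule cas_zip_shift[OF F ne])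
    have "hd p \<in> arcs F" using ps(1) pne by auto
    then have "fst (hd p) \<in> verts F" using wellformed(1)[of "hd p"] F by simp
    moreover have "fst (hd p) = hd vs" using fst pne by (metis hd_map)
    ultimately have "awalk (hd vs) p (hd vs)" using ps cas by (simp add: awalk_def)
    moreover have "distinct (tl vs @ [hd vs])"
      using vs(1) ne by (cases vs) (auto simp: cyclic_def)
    then have "distinct (tl (awalk_verts (hd vs) p))"
      using awalk_verts_conv'[OF cas] pne F snd by simp
    ultimately have "simple_cycle F p"
      using pne ps(2) vs(1) by (auto simp: simple_cycle_def cycle_def cyclic_def)
    moreover have "cycle_verts F p = X"
      using fst vs(2) F by (metis cycle_verts_def set_map)
    ultimately show "\<exists>p. simple_cycle F p \<and> cycle_verts F p = X" by blast
  }
qed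

section \<open>Edge sets of cycles and their disjoint unions\<close>

definition cycle_arcs :: "'v list \<Rightarrow> 'v rel" where
  "cycle_arcs vs = symcl (set (zip vs (rotate1 vs)))"

lemma sym_cycle_arcs: "sym (cycle_arcs vs)"
  by (auto simp: cycle_arcs_def symcl_def sym_def)

lemma cycle_arcs_subset: "cycle_arcs vs \<subseteq> set vs \<times> set vs"
  by (auto simp: cycle_arcs_def symcl_def dest: set_zip_leftD set_zip_rightD)

lemma set_zip_rotate1: "set (zip vs (rotate1 vs)) =
    {(vs ! i, vs ! (if Suc i = length vs then 0 else Suc i)) | i. i < length vs}"
proof -
  have "rotate1 vs ! i = vs ! (if Suc i = length vs then 0 else Suc i)" if "i < length vs" for i
    using that by (subst nth_rotate1) auto
  then show ?thesis by (auto simp: set_zip)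
qed

lemma card_cycle_arcs_Image:
  assumes "distinct vs" and "3 \<le> length vs" and "v \<in> set vs"
  shows "card (cycle_arcs vs `` {v}) = 2"
proof -
  obtain i where i: "i < length vs" "v = vs ! i" using assms(3) by (auto simp: in_set_conv_nth)
  \<comment> \<open>\<open>a\<close> and \<open>b\<close> are the positions cyclically after and
    before \<open>i\<close>; they differ because the length is at least 3.\<close>
  define a where "a = (if Suc i = length vs then 0 else Suc i)"
  define b where "b = (if i = 0 then length vs - 1 else i - 1)"
  have ab: "a < length vs" "b < length vs" "a \<noteq> b" using i assms(2) by (auto simp: a_def b_def)
  have inj: "vs ! k = vs ! l \<longleftrightarrow> k = l" if "k < length vs" "l < length vs" for k l
    using that assms(1) nth_eq_iff_index_eq by blast
  have "(v, w) \<in> cycle_arcs vs \<longleftrightarrow> w = vs ! a \<or> w = vs ! b" for w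
  proof -
    have "(v, w) \<in> set (zip vs (rotate1 vs)) \<longleftrightarrow> w = vs ! a"
    proof
      assume "(v, w) \<in> set (zip vs (rotate1 vs))"
      then obtain k where "k < length vs" "v = vs ! k"
        "w = vs ! (if Suc k = length vs then 0 else Suc k)"
        unfolding set_zip_rotate1 by blast
      then show "w = vs ! a" using i inj a_def by simp
    qed (use i a_def in \<open>auto simp: set_zip_rotate1\<close>)
    moreover have "(w, v) \<in> set (zip vs (rotate1 vs)) \<longleftrightarrow> w = vs ! b"
    proof
      assume "(w, v) \<in> set (zip vs (rotate1 vs))"
      then obtain k where k: "k < length vs" "w = vs ! k"
        "v = vs ! (if Suc k = length vs then 0 else Suc k)"
        unfolding set_zip_rotate1 by blast
      then have "i = (if Suc k = length vs then 0 else Suc k)"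
        using i inj[of i "if Suc k = length vs then 0 else Suc k"] by (cases vs) auto
      then have "k = b" using k(1) by (auto simp: b_def split: if_splits)
      then show "w = vs ! b" using k by simp
    next
      assume "w = vs ! b"
      moreover have "i = (if Suc b = length vs then 0 else Suc b)"
        using i by (auto simp: b_def)
      ultimately show "(w, v) \<in> set (zip vs (rotate1 vs))"
        using i(2) ab(2) unfolding set_zip_rotate1 by blast
    qed
    ultimately show ?thesis by (auto simp: cycle_arcs_def symcl_def)
  qed
  then have "cycle_arcs vs `` {v} = {vs ! a, vs ! b}" by auto
  then show ?thesis using inj ab by simp
qed

lemma set_subset_if_closed:
  assumes "u \<in> set vs" "u \<in> X"
    and "\<And>a b. (a, b) \<in> set (zip vs (rotate1 vs)) \<Longrightarrow> a \<in> X \<Longrightarrow> b \<in> X"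
  shows "set vs \<subseteq> X"
proof
  let ?n = "length vs"
  fix w assume "w \<in> set vs"
  then obtain i j where ij: "i < ?n" "u = vs ! i" "j < ?n" "w = vs ! j"
    using assms(1) by (auto simp: in_set_conv_nth)
  have step: "vs ! (Suc k mod ?n) \<in> X" if "k < ?n" "vs ! k \<in> X" for k
  proof (rule assms(3)[OF _ that(2)])
    show "(vs ! k, vs ! (Suc k mod ?n)) \<in> set (zip vs (rotate1 vs))"
      using that(1) nth_rotate1[OF that(1)] by (auto simp: set_zip)
  qed
  have pos: "0 < ?n" using ij by linarith
  have "vs ! ((i + k) mod ?n) \<in> X" for k
  proof (induction k)
    case (Suc k)
    have "vs ! (Suc ((i + k) mod ?n) mod ?n) \<in> X"
      using step[OF _ Suc] pos by simp
    then show ?case by (simp add: mod_Suc_eq)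
  qed (use ij assms(2) in simp)
  \<comment> \<open>This many steps lead from position \<open>i\<close> once past the end and on to
    position \<open>j\<close>; adding \<open>?n\<close> avoids a negative difference.\<close>
  from this[of "?n - i + j"] show "w \<in> X" using ij by simp
qed

text \<open>\<open>F\<close> is 2-regular and its arcs stay within single members of
  \<open>Cs\<close>. A cycle of \<open>F\<close> therefore remains in the member it meets, and since
  it uses both edges at each of its vertices it exhausts that member.\<close>

lemma cycles_of_disjoint_union:
  assumes Cs: "\<And>vs. vs \<in> Cs \<Longrightarrow> distinct vs \<and> 3 \<le> length vs"
    and disj: "\<And>vs ws. vs \<in> Cs \<Longrightarrow> ws \<in> Cs \<Longrightarrow> vs \<noteq> ws \<Longrightarrow> set vs \<inter> set ws = {}"
    and F: "F = (\<Union>vs\<in>Cs. cycle_arcs vs)"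
  shows "{set ws | ws. cyclic F ws} = set ` Cs"
    and "\<And>vs v. vs \<in> Cs \<Longrightarrow> v \<in> set vs \<Longrightarrow> card (F `` {v}) = 2"
proof -
  have nb: "F `` {v} = cycle_arcs vs `` {v}" if "vs \<in> Cs" "v \<in> set vs" for v vs
    using that disj cycle_arcs_subset unfolding F by fast
  show card: "card (F `` {v}) = 2" if "vs \<in> Cs" "v \<in> set vs" for v vs
    using nb[OF that] card_cycle_arcs_Image Cs that by metis
  have "set ws \<in> set ` Cs" if ws: "cyclic F ws" for ws
  proof -
    have zipF: "set (zip ws (rotate1 ws)) \<subseteq> F" and dws: "distinct ws" "3 \<le> length ws"
      using ws by (auto simp: cyclic_def)
    have "sym F"
      unfolding F by (rule sym_UNION) (simp add: sym_cycle_arcs)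
    then have arcsF: "cycle_arcs ws \<subseteq> F"
      using zipF unfolding cycle_arcs_def symcl_def by (auto dest: symD)
    obtain u where u: "u \<in> set ws" using dws by (cases ws) auto
    then have "cycle_arcs ws `` {u} \<noteq> {}"
      using card_cycle_arcs_Image[OF dws u] by auto
    then obtain vs where vs: "vs \<in> Cs" "u \<in> set vs"
      using arcsF cycle_arcs_subset unfolding F by blast
    have "set ws \<subseteq> set vs"
    proof (rule set_subset_if_closed[OF u vs(2)])
      fix a b assume "(a, b) \<in> set (zip ws (rotate1 ws))" "a \<in> set vs"
      then have "(a, b) \<in> cycle_arcs vs" using zipF nb[OF vs(1)] by blast
      then show "b \<in> set vs" using cycle_arcs_subset by blast
    qed
    moreover have "set vs \<subseteq> set ws"
    proof (rule set_subset_if_closed[OF vs(2) u])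
      fix a b assume ab: "(a, b) \<in> set (zip vs (rotate1 vs))" "a \<in> set ws"
      then have a: "a \<in> set vs" by (meson set_zip_leftD)
      have "finite (F `` {a})" using card[OF vs(1) a] by (intro card_ge_0_finite) simp
      moreover have "card (cycle_arcs ws `` {a}) = card (F `` {a})"
        using card[OF vs(1) a] card_cycle_arcs_Image[OF dws ab(2)] by simp
      \<comment> \<open>Both sides have two elements and one contains the other, so
        \<open>ws\<close> uses every edge of \<open>F\<close> at \<open>a\<close>.\<close>
      ultimately have "cycle_arcs ws `` {a} = F `` {a}"
        using arcsF by (intro card_subset_eq) auto
      moreover have "(a, b) \<in> F"
        using ab(1) vs(1) unfolding F cycle_arcs_def symcl_def by auto
      ultimately show "b \<in> set ws" using cycle_arcs_subset by blast
    qed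
    ultimately show ?thesis using vs(1) by blast
  qed
  moreover have "cyclic F vs" if "vs \<in> Cs" for vs
    using that Cs unfolding cyclic_def F cycle_arcs_def symcl_def by blast
  ultimately show "{set ws | ws. cyclic F ws} = set ` Cs" by blast
qed

section \<open>Star-like graphs\<close>

lemma cubic_iff:
  assumes "pair_graph G"
  shows "cubic G \<longleftrightarrow> (\<forall>v\<in>pverts G. card (parcs G `` {v}) = 3)"
proof -
  have "out_degree (with_proj G) v = card (parcs G `` {v})" for v
  proof -
    have "out_arcs (with_proj G) v = Pair v ` (parcs G `` {v})"
      by (auto simp: out_arcs_def)
    then show ?thesis by (simp add: out_degree_def card_image inj_on_def)
  qed
  then show ?thesis using assms by (simp add: cubic_def)
qed

lemma pair_graphI:
  assumes "finite (pverts G)" and "parcs G \<subseteq> pverts G \<times> pverts G" and "sym (parcs G)"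
    and "\<And>v. (v, v) \<notin> parcs G"
  shows "pair_graph G"
proof
  show "finite (parcs G)" using assms(1,2) finite_subset by blast
  show "symmetric (with_proj G)" using assms(3) by (simp add: symmetric_def)
qed (use assms in auto)

lemma star_star_graph:
  assumes K: "K = \<lparr>pverts = insert d S, parcs = {d} \<times> S \<union> S \<times> {d}\<rparr>" and d: "d \<notin> S"
  shows "star (with_proj K)"
  unfolding star_def
proof (intro conjI)
  interpret pair_wf_digraph K by unfold_locales (auto simp: K)
  have wf: "wf_digraph (with_proj K)" ..
  have wr: "parcs (mk_symmetric (with_proj K)) = parcs K"
    "pverts (mk_symmetric (with_proj K)) = pverts K"
    by (auto simp: mk_symmetric_def K)
  have dr: "(d, u) \<in> rtrancl_on (pverts K) (parcs K)" "(u, d) \<in> rtrancl_on (pverts K) (parcs K)"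
    if "u \<in> pverts K" for u
    using that by (cases "u = d"; auto simp: K intro: rtrancl_on_into_rtrancl_on[OF rtrancl_on_refl])+
  show "Digraph_Component.connected (with_proj K)"
    unfolding connected_def strongly_connected_def reachable_def with_proj_simps wr
    using dr by (auto intro: rtrancl_on_trans simp: K)
  show "\<nexists>p. simple_cycle (with_proj K) p"
  proof
    assume "\<exists>p. simple_cycle (with_proj K) p"
    then obtain ws where ws: "cyclic (parcs K) ws"
      using ex_simple_cycle_iff[OF wf] by (metis with_proj_simps(2,4,5))
    then obtain a b c rest where abc: "ws = a # b # c # rest"
      by (auto simp: cyclic_def numeral_3_eq_3 Suc_le_length_iff)
    with ws have "(a, b) \<in> parcs K" "(b, c) \<in> parcs K" "a \<noteq> c" "a \<noteq> b" "b \<noteq> c"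
      by (auto simp: cyclic_iff_successively)
    \<comment> \<open>Every arc meets \<open>d\<close>, so of three consecutive distinct vertices
      the middle one is \<open>d\<close>. The vertex after \<open>c\<close> would have to be
      \<open>d\<close> again, yet it is either \<open>a\<close> or a new vertex.\<close>
    then have bd: "b = d" "a \<in> S" "c \<in> S" using d by (auto simp: K)
    show False
    proof (cases rest)
      case Nil
      then have "(c, a) \<in> parcs K" using ws abc by (auto simp: cyclic_iff_successively)
      then show False using bd d by (auto simp: K)
    next
      case (Cons e es)
      then have "(c, e) \<in> parcs K" "e \<noteq> b"
        using ws abc by (auto simp: cyclic_iff_successively)
      then show False using bd d by (auto simp: K)
    qed
  qed
  have "\<exists>p. awalk u p v \<and> length p \<le> 2" if uv: "u \<in> pverts K" "v \<in> pverts K" for u v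
  proof -
    consider "u = v" | "u = d" "v \<in> S" | "v = d" "u \<in> S" | "u \<in> S" "v \<in> S"
      using uv by (auto simp: K)
    then show ?thesis
    proof cases
      case 1
      then show ?thesis using uv by (intro exI[of _ "[]"]) (simp add: awalk_def)
    next
      case 2
      then have "awalk u [(u, v)] v" unfolding awalk_def by (simp add: K)
      then show ?thesis by (intro exI[of _ "[(u, v)]"]) simp
    next
      case 3
      then have "awalk u [(u, v)] v" unfolding awalk_def by (simp add: K)
      then show ?thesis by (intro exI[of _ "[(u, v)]"]) simp
    next
      case 4
      then have "awalk u [(u, d), (d, v)] v" unfolding awalk_def by (simp add: K)
      then show ?thesis by (intro exI[of _ "[(u, d), (d, v)]"]) simp
    qed
  qed
  moreover have "\<mu> (\<lambda>_. 1) u v \<le> 2" if "awalk u p v" "length p \<le> 2" for u v p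
  proof -
    have "\<mu> (\<lambda>_. 1) u v \<le> ereal (awalk_cost (\<lambda>_. 1) p)"
      unfolding \<mu>_def using that(1) by (intro INF_lower) simp
    also have "awalk_cost (\<lambda>_. 1) p = length p"
      by (simp add: awalk_cost_def sum_list_triv)
    also have "ereal (real (length p)) \<le> 2" using that(2) by simp
    finally show ?thesis .
  qed
  ultimately show "diameter (with_proj K) \<le> 2"
    unfolding diameter_def by (intro SUP_least) fastforce
qed

text \<open>The matching consists of all edges off the given cycles: at each vertex the cycles use
  two of three edges. The centre of the contracted star is \<open>d\<close>, its leaves are the
  members of \<open>L\<close>.\<close>

lemma star_likeI:
  assumes cubic: "cubic G" and conn: "Digraph_Component.connected (with_proj G)"
    and cyc: "cyclic (parcs G) d" "\<And>c. c \<in> L \<Longrightarrow> cyclic (parcs G) c"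
    and disj: "\<And>vs ws. vs \<in> insert d L \<Longrightarrow> ws \<in> insert d L \<Longrightarrow> vs \<noteq> ws \<Longrightarrow> set vs \<inter> set ws = {}"
    and cover: "pverts G = (\<Union>vs\<in>insert d L. set vs)"
    and leaf: "\<And>c. c \<in> L \<Longrightarrow> \<exists>u\<in>set d. \<exists>v\<in>set c. (u, v) \<in> parcs G"
    and nonadj: "\<And>c c' u v. c \<in> L \<Longrightarrow> c' \<in> L \<Longrightarrow> c \<noteq> c' \<Longrightarrow> u \<in> set c \<Longrightarrow> v \<in> set c' \<Longrightarrow>
      (u, v) \<notin> parcs G"
    and d: "d \<notin> L"
  shows "star_like G"
proof -
  interpret pair_graph G using cubic by (simp add: cubic_def)
  define F where "F = (\<Union>vs\<in>insert d L. cycle_arcs vs)"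
  define M where "M = parcs G - F"
  have cyc': "cyclic (parcs G) vs" if "vs \<in> insert d L" for vs using cyc that by blast
  then have dl: "distinct vs \<and> 3 \<le> length vs" if "vs \<in> insert d L" for vs
    using that by (simp add: cyclic_def)
  note cycles = cycles_of_disjoint_union[OF dl disj F_def]
  have symG: "sym (parcs G)" using arcs_symmetric by (auto simp: sym_def)
  have FG: "F \<subseteq> parcs G"
  proof -
    have "cycle_arcs vs \<subseteq> parcs G" if "vs \<in> insert d L" for vs
      using cyc'[OF that] symG by (auto simp: cyclic_def cycle_arcs_def symcl_def dest: symD)
    then show ?thesis unfolding F_def by blast
  qed
  have symF: "sym F"
    unfolding F_def by (rule sym_UNION) (simp add: sym_cycle_arcs)
  have "\<exists>!w. (v, w) \<in> M" if v: "v \<in> pverts G" for v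
  proof -
    have "card (parcs G `` {v}) = 3"
      using cubic v cubic_iff[OF pair_graph] by blast
    moreover have "card (F `` {v}) = 2" using cycles(2) v cover by blast
    moreover have "M `` {v} = parcs G `` {v} - F `` {v}" by (auto simp: M_def)
    moreover have "F `` {v} \<subseteq> parcs G `` {v}" using FG by blast
    moreover have "finite (F `` {v})"
      using \<open>card (F `` {v}) = 2\<close> by (intro card_ge_0_finite) simp
    ultimately have "card (M `` {v}) = 1" by (simp add: card_Diff_subset)
    then obtain w where "M `` {v} = {w}" by (meson card_1_singletonE)
    then show ?thesis by (metis Image_singleton_iff singleton_iff)
  qed
  then have "perfect_matching G M"
    unfolding perfect_matching_def M_def using symG symF by (auto simp: sym_def)
  moreover have "star (with_proj (contract_cycles G M))"
  proof -
    have del: "delete_edges G M = \<lparr>pverts = pverts G, parcs = F\<rparr>"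
      using FG by (auto simp: delete_edges_def M_def)
    have wf: "wf_digraph (with_proj (delete_edges G M))"
      unfolding wf_digraph_wp_iff del
      by unfold_locales (auto dest!: subsetD[OF FG] dest: in_arcsD1 in_arcsD2)
    note cyc_iff = ex_simple_cycle_iff[OF wf, unfolded with_proj_simps, OF refl refl]
    have "{cycle_verts (with_proj (delete_edges G M)) p | p.
        simple_cycle (with_proj (delete_edges G M)) p} = {set ws | ws. cyclic F ws}"
      (is "?S = ?T")
    proof
      show "?S \<subseteq> ?T"
      proof
        fix X assume "X \<in> ?S"
        then have "\<exists>p. simple_cycle (with_proj (delete_edges G M)) p \<and>
            cycle_verts (with_proj (delete_edges G M)) p = X" by blast
        then have "\<exists>vs. cyclic (parcs (delete_edges G M)) vs \<and> set vs = X" unfolding cyc_iff .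
        then show "X \<in> ?T" by (auto simp: del)
      qed
      show "?T \<subseteq> ?S"
      proof
        fix X assume "X \<in> ?T"
        then have "\<exists>vs. cyclic (parcs (delete_edges G M)) vs \<and> set vs = X" by (auto simp: del)
        then show "X \<in> ?S" unfolding cyc_iff[symmetric] by blast
      qed
    qed
    with cycles(1) have verts: "{cycle_verts (with_proj (delete_edges G M)) p | p.
        simple_cycle (with_proj (delete_edges G M)) p} = set ` insert d L" by simp
    have ne: "set vs \<noteq> {}" if "vs \<in> insert d L" for vs using dl[OF that] by auto
    have dS: "set d \<notin> set ` L" using ne disj d by (metis imageE inf.idem insertCI)
    \<comment> \<open>An edge between two different cycles lies on none of them and hence belongs to
      the matching.\<close>
    have FM: "(u, v) \<in> M" if "(u, v) \<in> parcs G" "u \<in> set vs" "v \<in> set ws"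
      "vs \<in> insert d L" "ws \<in> insert d L" "vs \<noteq> ws" for u v vs ws
    proof -
      have "(u, v) \<notin> F"
      proof
        assume "(u, v) \<in> F"
        then obtain xs where xs: "xs \<in> insert d L" "(u, v) \<in> cycle_arcs xs"
          unfolding F_def by (elim UN_E)
        then have "u \<in> set xs" "v \<in> set xs" using cycle_arcs_subset[of xs] by auto
        then have "xs = vs" "xs = ws"
          using disj[OF xs(1) that(4)] disj[OF xs(1) that(5)] that(2,3) by auto
        then show False using that(6) by simp
      qed
      then show ?thesis using that(1) by (simp add: M_def)
    qed
    have leafM: "\<exists>u\<in>set d. \<exists>v\<in>set c. (u, v) \<in> M" if c: "c \<in> L" for c
      using leaf[OF c] FM[of _ _ d c] c d by blast
    have symM: "sym M" using symG symF by (auto simp: M_def sym_def)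
    have arcs: "{(C, D). C \<in> set ` insert d L \<and> D \<in> set ` insert d L \<and> C \<noteq> D \<and>
        (\<exists>u\<in>C. \<exists>v\<in>D. (u, v) \<in> M)} = {set d} \<times> set ` L \<union> set ` L \<times> {set d}" (is "?A = ?B")
    proof
      have "(set c, set c') \<notin> ?A" if "c \<in> L" "c' \<in> L" for c c'
        using nonadj[OF that] by (auto simp: M_def)
      then show "?A \<subseteq> ?B" by auto
      have "(set d, set c) \<in> ?A \<and> (set c, set d) \<in> ?A" if "c \<in> L" for c
      proof -
        have "set d \<noteq> set c" using dS that by blast
        moreover have "\<exists>v\<in>set c. \<exists>u\<in>set d. (v, u) \<in> M"
          using leafM[OF that] symD[OF symM] by meson
        ultimately show ?thesis using leafM[OF that] that by simp
      qed
      note BA = this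
      show "?B \<subseteq> ?A"
      proof
        fix x assume "x \<in> ?B"
        then obtain c where c: "c \<in> L" "x = (set d, set c) \<or> x = (set c, set d)" by auto
        from c(2) show "x \<in> ?A" using BA[OF c(1)] by (elim disjE) (simp_all only:)
      qed
    qed
    have "contract_cycles G M =
        \<lparr>pverts = insert (set d) (set ` L), parcs = {set d} \<times> set ` L \<union> set ` L \<times> {set d}\<rparr>"
      by (simp only: contract_cycles_def Let_def verts arcs[unfolded image_insert] image_insert)
    then show ?thesis using dS by (rule star_star_graph)
  qed
  ultimately show ?thesis
    unfolding star_like_def using cubic conn by blast
qed

section \<open>Hamiltonian paths and cuts of three edges\<close>

text \<open>\<open>ys\<close> is the maximal run inside \<open>A\<close> that begins at the first
  vertex of \<open>A\<close>. The ends of \<open>p\<close> lie outside \<open>A\<close>, which makes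
  the pieces before and after it nonempty.\<close>

lemma split_first_visit:
  assumes "set p \<inter> A \<noteq> {}" and "hd p \<notin> A" and "last p \<notin> A"
  obtains xs ys zs where "p = xs @ ys @ zs" "xs \<noteq> []" "ys \<noteq> []" "zs \<noteq> []"
    "set xs \<inter> A = {}" "set ys \<subseteq> A" "hd zs \<notin> A"
proof -
  define xs where "xs = takeWhile (\<lambda>v. v \<notin> A) p"
  define q where "q = dropWhile (\<lambda>v. v \<notin> A) p"
  define ys where "ys = takeWhile (\<lambda>v. v \<in> A) q"
  define zs where "zs = dropWhile (\<lambda>v. v \<in> A) q"
  have p: "p = xs @ ys @ zs" by (simp add: xs_def q_def ys_def zs_def)
  have "q \<noteq> []" using assms(1) by (auto simp: q_def dropWhile_eq_Nil_conv)
  then have hq: "hd q \<in> A" using hd_dropWhile[of "\<lambda>v. v \<notin> A" p] by (simp add: q_def)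
  have ys: "ys \<noteq> []" using \<open>q \<noteq> []\<close> hq by (cases q) (auto simp: ys_def)
  have ysA: "set ys \<subseteq> A" by (auto simp: ys_def dest: set_takeWhileD)
  have zs: "zs \<noteq> []"
  proof
    assume "zs = []"
    then have "last p = last ys" using p ys by simp
    then show False using ysA assms(3) last_in_set[OF ys] by auto
  qed
  have "hd zs \<notin> A" using hd_dropWhile[of "\<lambda>v. v \<in> A" q] zs by (simp add: zs_def)
  moreover have "xs \<noteq> []"
  proof
    assume "xs = []"
    then have "hd p = hd ys" using p ys by simp
    then show False using ysA assms(2) hd_in_set[OF ys] by auto
  qed
  moreover have "set xs \<inter> A = {}" by (auto simp: xs_def dest: set_takeWhileD)
  ultimately show ?thesis using that[of xs ys zs] p ys zs ysA by blast
qed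

text \<open>An attachment vertex has the single outside neighbour \<open>out a\<close>. A run with
  equal first and last vertex would be preceded and followed by the same vertex, which a path cannot
  repeat.\<close>

lemma hd_neq_last_of_visit:
  assumes p: "successively (\<lambda>u v. (u, v) \<in> E) (xs @ ys @ zs)" "distinct (xs @ ys @ zs)"
    and ne: "xs \<noteq> []" "ys \<noteq> []" "zs \<noteq> []"
    and A: "last xs \<notin> A" "set ys \<subseteq> A" "hd zs \<notin> A"
    and bd: "\<And>a b. a \<in> A \<Longrightarrow> b \<notin> A \<Longrightarrow> (a, b) \<in> E \<or> (b, a) \<in> E \<Longrightarrow> a \<in> T \<and> b = out a"
  shows "hd ys \<in> T" and "last ys \<in> T" and "hd ys \<noteq> last ys"
proof -
  have 1: "(last xs, hd ys) \<in> E" "(last ys, hd zs) \<in> E"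
    using p(1) ne by (auto simp: successively_append_iff)
  have 2: "hd ys \<in> A" "last ys \<in> A" using A(2) ne by auto
  show "hd ys \<in> T" "last ys \<in> T" using 1 2 A bd by blast+
  have "last xs \<noteq> hd zs"
    using p(2) hd_in_set[OF ne(3)] last_in_set[OF ne(1)] by auto
  moreover have "last xs = out (hd ys)" "hd zs = out (last ys)" using 1 2 A bd by blast+
  ultimately show "hd ys \<noteq> last ys" by auto
qed

lemma path_inside_three_cut:
  assumes p: "successively (\<lambda>u v. (u, v) \<in> E) p" "distinct p"
    and A: "A \<noteq> {}" "A \<subseteq> set p" "hd p \<notin> A" "last p \<notin> A"
    and bd: "\<And>a b. a \<in> A \<Longrightarrow> b \<notin> A \<Longrightarrow> (a, b) \<in> E \<or> (b, a) \<in> E \<Longrightarrow> a \<in> T \<and> b = out a"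
    and T: "finite T" "card T \<le> 3"
  obtains ys where "distinct ys" "set ys = A" "successively (\<lambda>u v. (u, v) \<in> E) ys"
    "hd ys \<in> T" "last ys \<in> T" "hd ys \<noteq> last ys"
proof -
  obtain xs ys zs where s: "p = xs @ ys @ zs" "xs \<noteq> []" "ys \<noteq> []" "zs \<noteq> []"
    "set xs \<inter> A = {}" "set ys \<subseteq> A" "hd zs \<notin> A"
    using split_first_visit[of p A] A by blast
  have lx: "last xs \<notin> A" using s by (meson disjoint_iff last_in_set)
  note ends = hd_neq_last_of_visit[OF p[unfolded s(1)] s(2-4) lx s(6,7) bd]
  have "set zs \<inter> A = {}"
  proof (rule ccontr)
    assume "set zs \<inter> A \<noteq> {}"
    moreover have "last zs \<notin> A" using A(4) s by simp
    ultimately obtain xs' ys' zs' where s': "zs = xs' @ ys' @ zs'" "xs' \<noteq> []" "ys' \<noteq> []" "zs' \<noteq> []"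
      "set xs' \<inter> A = {}" "set ys' \<subseteq> A" "hd zs' \<notin> A"
      using split_first_visit[of zs A] s(7) by blast
    have lx': "last xs' \<notin> A" using s' by (meson disjoint_iff last_in_set)
    have "successively (\<lambda>u v. (u, v) \<in> E) (xs' @ ys' @ zs')" "distinct (xs' @ ys' @ zs')"
      using p s(1) s'(1) by (auto simp: successively_append_iff)
    note ends' = hd_neq_last_of_visit[OF this s'(2-4) lx' s'(6,7) bd]
    have "set ys \<inter> set ys' = {}" using p(2) s(1) s'(1) by auto
    then have "hd ys \<noteq> hd ys'" "hd ys \<noteq> last ys'" "last ys \<noteq> hd ys'" "last ys \<noteq> last ys'"
      using s(3) s'(3) hd_in_set last_in_set by (metis disjoint_iff)+
    \<comment> \<open>A second run would bring the number of attachment vertices to four.\<close>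
    then have "card {hd ys, last ys, hd ys', last ys'} = 4"
      using ends ends' by simp
    moreover have "card {hd ys, last ys, hd ys', last ys'} \<le> card T"
      using T(1) ends ends' by (intro card_mono) auto
    ultimately show False using T(2) by simp
  qed
  then have "set ys = A" using A(2) s by auto
  moreover have "distinct ys" "successively (\<lambda>u v. (u, v) \<in> E) ys"
    using p s(1) by (auto simp: successively_append_iff)
  ultimately show ?thesis using that ends by blast
qed

section \<open>Paths and Hamiltonicity in terms of vertex lists\<close>

lemma vpath_successively:
  assumes "vpath p (with_proj G)"
  shows "distinct p" and "successively (\<lambda>u v. (u, v) \<in> parcs G) p"
proof -
  show "distinct p" using assms by (simp add: vpath_def)
  have "set (vwalk_arcs p) \<subseteq> parcs G" using assms by (simp add: vpath_def vwalk_def)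
  then show "successively (\<lambda>u v. (u, v) \<in> parcs G) p"
    by (induction p rule: vwalk_arcs.induct) auto
qed

lemma hamiltonian_iff:
  assumes "pair_wf_digraph G"
  shows "hamiltonian (with_proj G) \<longleftrightarrow> (\<exists>vs. cyclic (parcs G) vs \<and> set vs = pverts G)"
  using ex_simple_cycle_iff[of "with_proj G" "pverts G"] assms
  by (simp add: hamiltonian_def wf_digraph_wp_iff)

lemma hamiltonian_del_vert_iff:
  assumes "pair_wf_digraph G"
  shows "hamiltonian (pre_digraph.del_vert (with_proj G) z) \<longleftrightarrow>
    (\<exists>vs. cyclic (Restr (parcs G) (- {z})) vs \<and> set vs = pverts G - {z})"
proof -
  interpret pair_wf_digraph G by fact
  have "wf_digraph (del_vert z)" by (rule wf_digraph_del_vert)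
  moreover have "arcs (del_vert z) = Restr (parcs G) (- {z})" by (auto simp: del_vert_simps)
  ultimately show ?thesis
    using ex_simple_cycle_iff[of "del_vert z" "pverts G - {z}"]
    by (simp add: hamiltonian_def del_vert_simps)
qed

section \<open>Joining three parts\<close>

text \<open>The joining sees of a part only the vertex \<open>w\<close> to be deleted and its
  neighbours, with \<open>p i 1\<close>, \<open>p i 2\<close>, \<open>p i 3\<close> in the roles of
  a, b and c. The proofs about joining thus stay free of the inner structure of the parts.\<close>

locale three_parts =
  fixes P :: "nat \<Rightarrow> 'b pair_pre_digraph" and w :: 'b and p :: "nat \<Rightarrow> nat \<Rightarrow> 'b"
  assumes graph: "i \<in> {1, 2, 3} \<Longrightarrow> pair_graph (P i)"
    and w: "i \<in> {1, 2, 3} \<Longrightarrow> w \<in> pverts (P i)"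
    and nb_w: "i \<in> {1, 2, 3} \<Longrightarrow> parcs (P i) `` {w} = {p i 1, p i 2, p i 3}"
    and p_neq: "i \<in> {1, 2, 3} \<Longrightarrow> p i 1 \<noteq> p i 2 \<and> p i 1 \<noteq> p i 3 \<and> p i 2 \<noteq> p i 3"
begin

definition J :: "'b joined_vertex pair_pre_digraph" where
  "J = join_parts (\<lambda>i. pre_digraph.del_vert (with_proj (P i)) w) (\<lambda>i. p i 1) (\<lambda>i. p i 2) (\<lambda>i. p i 3)"

lemma p_in: "i \<in> {1, 2, 3} \<Longrightarrow> k \<in> {1, 2, 3} \<Longrightarrow> p i k \<in> pverts (P i) - {w}"
proof -
  assume i: "i \<in> {1, 2, 3}" and k: "k \<in> {1, 2, 3}"
  interpret pair_graph "P i" by (rule graph[OF i])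
  have "(w, p i k) \<in> parcs (P i)" using nb_w[OF i] k by auto
  then show ?thesis using no_loops' wellformed' by blast
qed

text \<open>
  The outer edges when only the parts in \<open>D\<close> are present and every other part is shrunk to its
  vertex \<open>w\<close>: for \<open>D = {}\<close> the graph is \<open>K\<^sub>4\<close>, for \<open>D = {1, 2, 3}\<close> it is \<open>J\<close>.
\<close>

definition port :: "nat set \<Rightarrow> nat \<Rightarrow> nat \<Rightarrow> 'b joined_vertex" where
  "port D i k = Part i (if i \<in> D then p i k else w)"

definition links :: "nat set \<Rightarrow> 'b joined_vertex rel" where
  "links D = symcl {(Hub, port D 1 1), (Hub, port D 2 1), (Hub, port D 3 1),
     (port D 1 2, port D 2 3), (port D 2 2, port D 3 3), (port D 3 2, port D 1 3)}"

definition stage_verts :: "nat set \<Rightarrow> 'b joined_vertex set" where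
  "stage_verts D = insert Hub (\<Union>i\<in>{1, 2, 3}. Part i ` (if i \<in> D then pverts (P i) - {w} else {w}))"

definition stage_arcs :: "nat set \<Rightarrow> 'b joined_vertex rel" where
  "stage_arcs D = (\<Union>i\<in>{1, 2, 3} \<inter> D. map_prod (Part i) (Part i) ` Restr (parcs (P i)) (- {w})) \<union> links D"

lemma pverts_J: "pverts J = stage_verts {1, 2, 3}"
  by (simp add: J_def join_parts_def stage_verts_def pre_digraph.del_vert_def)

lemma parcs_J: "parcs J = stage_arcs {1, 2, 3}"
proof -
  have "{a \<in> parcs (P i). fst a \<noteq> w \<and> snd a \<noteq> w} = Restr (parcs (P i)) (- {w})" for i
    by auto
  then show ?thesis
    by (simp add: J_def join_parts_def stage_arcs_def pre_digraph.del_vert_def links_def port_def)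
qed

lemma sym_stage_arcs: "sym (stage_arcs D)"
proof -
  have "sym (map_prod (Part i) (Part i) ` Restr (parcs (P i)) (- {w}))" if "i \<in> {1, 2, 3}" for i
  proof -
    interpret pair_graph "P i" by (rule graph[OF that])
    have "sym (Restr (parcs (P i)) (- {w}))" using arcs_symmetric by (auto simp: sym_def)
    then show ?thesis by (rule sym_map_prod_image)
  qed
  then have "sym (\<Union>i\<in>{1, 2, 3} \<inter> D. map_prod (Part i) (Part i) ` Restr (parcs (P i)) (- {w}))"
    by (intro sym_UNION) simp
  then show ?thesis unfolding stage_arcs_def links_def by (intro sym_Un sym_symcl)
qed

lemma stage_arcs_inner:
  "i \<in> {1, 2, 3} \<Longrightarrow> (Part i u, Part i v) \<in> stage_arcs D \<longleftrightarrow>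
     i \<in> D \<and> (u, v) \<in> parcs (P i) \<and> u \<noteq> w \<and> v \<noteq> w"
proof -
  have "(Part i u, Part i v) \<notin> links D"
    by (auto simp: links_def port_def split del: if_split)
  then show "i \<in> {1, 2, 3} \<Longrightarrow> ?thesis" unfolding stage_arcs_def by auto
qed

lemma finite_J: "finite (pverts J)"
proof -
  have "finite (pverts (P i))" if "i \<in> {1, 2, 3}" for i
  proof -
    interpret pair_graph "P i" by (rule graph[OF that])
    show ?thesis by (rule pair_finite_verts)
  qed
  then show ?thesis by (auto simp: pverts_J stage_verts_def)
qed

lemma pair_graph_J: "pair_graph J"
proof (rule pair_graphI[OF finite_J])
  show "sym (parcs J)" unfolding parcs_J by (rule sym_stage_arcs)
  have wf: "(u, v) \<in> parcs (P i) \<Longrightarrow> u \<in> pverts (P i) \<and> v \<in> pverts (P i) \<and> u \<noteq> v"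
    if "i \<in> {1, 2, 3}" for i u v
  proof -
    interpret pair_graph "P i" by (rule graph[OF that])
    show "(u, v) \<in> parcs (P i) \<Longrightarrow> ?thesis" using no_loops' wellformed' by blast
  qed
  have inner: "(\<Union>i\<in>{1, 2, 3}. map_prod (Part i) (Part i) ` Restr (parcs (P i)) (- {w}))
      \<subseteq> pverts J \<times> pverts J"
    using wf by (fastforce simp: pverts_J stage_verts_def)
  have "links {1, 2, 3} \<subseteq> pverts J \<times> pverts J"
    using p_in by (simp add: links_def port_def pverts_J stage_verts_def)
  with inner show "parcs J \<subseteq> pverts J \<times> pverts J"
    unfolding parcs_J stage_arcs_def by simp
  show "(v, v) \<notin> parcs J" for v
    using wf by (auto simp: parcs_J stage_arcs_def links_def port_def)
qed

text \<open>A neighbour of \<open>w\<close> loses the edge to \<open>w\<close> and gains exactly one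
  outer edge; all other vertices of a part keep their neighbours.\<close>

lemma cubic_J:
  assumes cubic: "\<And>i. i \<in> {1, 2, 3} \<Longrightarrow> cubic (P i)"
  shows "cubic J"
  unfolding cubic_iff[OF pair_graph_J]
proof
  fix v assume "v \<in> pverts J"
  then consider "v = Hub" | i u where "i \<in> {1, 2, 3}" "v = Part i u" "u \<in> pverts (P i)" "u \<noteq> w"
    unfolding pverts_J stage_verts_def by auto
  then show "card (parcs J `` {v}) = 3"
  proof cases
    case 1
    then have "parcs J `` {v} = {Part 1 (p 1 1), Part 2 (p 2 1), Part 3 (p 3 1)}"
      by (auto simp: parcs_J stage_arcs_def links_def port_def)
    then show ?thesis by simp
  next
    case (2 i u)
    interpret pair_graph "P i" by (rule graph[OF 2(1)])
    have card3: "card (parcs (P i) `` {u}) = 3"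
      using cubic[OF 2(1)] 2(3) cubic_iff[OF graph[OF 2(1)]] by blast
    have eq: "parcs J `` {v} = Part i ` (parcs (P i) `` {u} - {w}) \<union> links {1, 2, 3} `` {v}"
      using 2 by (auto simp: parcs_J stage_arcs_def)
    have uw: "(u, w) \<in> parcs (P i) \<longleftrightarrow> u \<in> {p i 1, p i 2, p i 3}"
      using nb_w[OF 2(1)] arcs_symmetric by blast
    have fin: "finite (parcs (P i) `` {u})" using card3 by (intro card_ge_0_finite) simp
    show ?thesis
    proof (cases "(u, w) \<in> parcs (P i)")
      case True
      then have "u \<in> {p i 1, p i 2, p i 3}" using uw by blast
      then have "\<exists>y. links {1, 2, 3} `` {v} = {y} \<and> y \<notin> range (Part i)"
        using 2(1,2) p_neq[OF 2(1)]
        by (elim insertE emptyE; hypsubst; auto simp: links_def port_def Image_def)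
      then obtain y where y: "links {1, 2, 3} `` {v} = {y}" "y \<notin> range (Part i)" by blast
      have "card (Part i ` (parcs (P i) `` {u} - {w})) = 2"
        using True card3 by (subst card_image) (auto simp: inj_on_def)
      moreover have "y \<notin> Part i ` (parcs (P i) `` {u} - {w})" using y(2) by blast
      ultimately show ?thesis unfolding eq y(1) using fin by simp
    next
      case False
      then have "links {1, 2, 3} `` {v} = {}"
        using uw 2(1,2) by (auto simp: links_def port_def)
      moreover have "card (Part i ` (parcs (P i) `` {u} - {w})) = 3"
        using False card3 by (subst card_image) (auto simp: inj_on_def)
      ultimately show ?thesis unfolding eq by simp
    qed
  qed
qed

text \<open>As long as \<open>i\<close> is not in \<open>D\<close>, part \<open>i\<close> is the
  single vertex \<open>Part i w\<close> with three neighbours. Splicing in \<open>P i\<close> at its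
  own vertex \<open>w\<close> expands it.\<close>

lemma tri_connected_stage_insert:
  assumes P: "tri_connected (pverts (P i)) (parcs (P i))" and D: "tri_connected (stage_verts D) (stage_arcs D)"
    and i: "i \<in> {1, 2, 3}" "i \<notin> D"
  shows "tri_connected (stage_verts (insert i D)) (stage_arcs (insert i D))"
proof -
  interpret pair_graph "P i" by (rule graph[OF i(1)])
  \<comment> \<open>\<open>t k\<close> is the far end of the outer edge at port \<open>k\<close> of
    part \<open>i\<close>: the hub for a, port c of the cyclically next part for b, port b of the
    previous part for c.\<close>
  define t :: "nat \<Rightarrow> 'b joined_vertex" where
    "t k = (if k = 1 then Hub
            else if k = 2 then port D (if i = 1 then 2 else if i = 2 then 3 else 1) 3
            else port D (if i = 1 then 3 else if i = 2 then 1 else 2) 2)" for k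
  define r :: "nat \<Rightarrow> 'b joined_vertex" where "r k = Part i (p i k)" for k
  let ?f = "map_prod (Part i) (Part i)"
  have W: "tri_connected (Part i ` pverts (P i)) (?f ` parcs (P i))"
    by (rule tri_connected_image[OF P _ pair_finite_verts]) (simp add: inj_on_def)
  have symW: "sym (?f ` parcs (P i))"
    by (rule sym_map_prod_image) (use arcs_symmetric in \<open>auto simp: sym_def\<close>)
  have nbW: "(?f ` parcs (P i)) `` {Part i w} \<inter> Part i ` pverts (P i) \<subseteq> {r 1, r 2, r 3}"
  proof -
    have "(?f ` parcs (P i)) `` {Part i w} = Part i ` (parcs (P i) `` {w})" by auto
    then show ?thesis using nb_w[OF i(1)] by (auto simp: r_def)
  qed
  have nbD: "stage_arcs D `` {Part i w} \<inter> stage_verts D \<subseteq> {t 1, t 2, t 3}"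
  proof -
    have port_eq: "port D j k = Part i w \<longleftrightarrow> j = i" "Part i w = port D j k \<longleftrightarrow> j = i" for j k
      using i(2) by (auto simp: port_def)
    have "y \<in> {t 1, t 2, t 3}" if "(Part i w, y) \<in> stage_arcs D" for y
    proof -
      have "(Part i w, y) \<in> links D" using that by (auto simp: stage_arcs_def)
      then have y: "1 = i \<and> y \<in> {Hub, port D 2 3, port D 3 2} \<or>
          2 = i \<and> y \<in> {Hub, port D 1 2, port D 3 3} \<or> 3 = i \<and> y \<in> {Hub, port D 2 2, port D 1 3}"
        unfolding links_def symcl_insert symcl_empty insert_iff empty_iff prod.inject port_eq by blast
      have "t 1 = Hub" "i = 1 \<Longrightarrow> t 2 = port D 2 3 \<and> t 3 = port D 3 2"
        "i = 2 \<Longrightarrow> t 2 = port D 3 3 \<and> t 3 = port D 1 2" "i = 3 \<Longrightarrow> t 2 = port D 1 3 \<and> t 3 = port D 2 2"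
        by (simp_all add: t_def)
      with y show ?thesis by (elim disjE) (simp_all, blast+)
    qed
    then show ?thesis by blast
  qed
  have t: "inj_on t {1, 2, 3}" "t ` {1, 2, 3} \<subseteq> stage_verts D - {Part i w}"
    using i p_in by (auto simp: t_def port_def stage_verts_def)
  have r: "inj_on r {1, 2, 3}" "r ` {1, 2, 3} \<subseteq> Part i ` pverts (P i) - {Part i w}"
    using i p_in p_neq[OF i(1)] by (auto simp: r_def)
  have E1: "Restr (stage_arcs D) (stage_verts D - {Part i w}) \<subseteq> stage_arcs (insert i D)"
  proof -
    have "Restr (links D) (- {Part i w}) \<subseteq> links (insert i D)"
      using i by (auto simp: links_def port_def)
    then show ?thesis unfolding stage_arcs_def by blast
  qed
  have E2: "Restr (?f ` parcs (P i)) (Part i ` pverts (P i) - {Part i w}) \<subseteq> stage_arcs (insert i D)"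
    using i by (force simp: stage_arcs_def)
  have uD: "Part i w \<in> stage_verts D" and wW: "Part i w \<in> Part i ` pverts (P i)"
    using i w by (auto simp: stage_verts_def)
  have disj: "(stage_verts D - {Part i w}) \<inter> (Part i ` pverts (P i) - {Part i w}) = {}"
    using i by (auto simp: stage_verts_def split: if_splits)
  have tr: "(t k, r k) \<in> stage_arcs (insert i D)" if "k \<in> {1, 2, 3}" for k
    using that i by (auto simp: t_def r_def stage_arcs_def links_def port_def)
  have "tri_connected (stage_verts D - {Part i w} \<union> (Part i ` pverts (P i) - {Part i w}))
      (stage_arcs (insert i D))"
    by (rule tri_connected_splice[OF D sym_stage_arcs uD nbD W symW wW nbW disj t r
          sym_stage_arcs E1 E2 tr])
  moreover have "stage_verts D - {Part i w} \<union> (Part i ` pverts (P i) - {Part i w})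
      = stage_verts (insert i D)"
    using i by (auto simp: stage_verts_def split: if_splits)
  ultimately show ?thesis by simp
qed

lemma tri_connected_J:
  assumes "\<And>i. i \<in> {1, 2, 3} \<Longrightarrow> tri_connected (pverts (P i)) (parcs (P i))"
  shows "tri_connected (pverts J) (parcs J)"
proof -
  \<comment> \<open>In a complete graph whatever remains after a deletion is linked.\<close>
  have "(u, v) \<in> stage_arcs {}" if "u \<in> stage_verts {}" "v \<in> stage_verts {}" "u \<noteq> v" for u v
    using that by (auto simp: stage_verts_def stage_arcs_def links_def port_def)
  then have "tri_connected (stage_verts {}) (stage_arcs {})"
    unfolding tri_connected_def linked_def
    by (metis DiffD1 rtrancl_on_into_rtrancl_on rtrancl_on_refl)
  from tri_connected_stage_insert[OF assms this, of 3]
  have "tri_connected (stage_verts {3}) (stage_arcs {3})" by simp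
  from tri_connected_stage_insert[OF assms this, of 2]
  have "tri_connected (stage_verts {2, 3}) (stage_arcs {2, 3})" by simp
  from tri_connected_stage_insert[OF assms this, of 1] show ?thesis
    unfolding pverts_J parcs_J by simp
qed

end

section \<open>A single part\<close>

text \<open>The vertices of a part outside the copy of \<open>H - z\<close>, with \<open>Zv'\<close>
  already deleted. \<open>Orig z\<close> is among them, being a corner of the former
  triangle.\<close>

definition gadget_verts :: "'a \<Rightarrow> 'a part_vertex set" where
  "gadget_verts z =
    {Orig z, Xv, Yv, Rv 1, Rv 2, Rv 3, Gv 1, Gv 2, Gv 3, Ov 1, Ov 2, Ov 3, Xv', Yv'}"

definition gadget_arcs :: "'a \<Rightarrow> 'a part_vertex rel" where
  "gadget_arcs z = symcl
    {(Xv, Rv 1), (Rv 1, Gv 1), (Gv 1, Yv), (Yv, Rv 2), (Rv 2, Gv 2), (Gv 2, Orig z),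
     (Orig z, Rv 3), (Rv 3, Gv 3), (Gv 3, Xv), (Xv', Rv 1), (Xv', Rv 2), (Xv', Rv 3),
     (Yv', Ov 1), (Yv', Ov 2), (Yv', Ov 3), (Ov 1, Gv 1), (Ov 2, Gv 2), (Ov 3, Gv 3)}"

text \<open>
  The part with \<open>H - z\<close> shrunk to a single vertex, for which the unused name \<open>Rv 0\<close> serves.
\<close>

definition capped_gadget_arcs :: "'a \<Rightarrow> 'a part_vertex rel" where
  "capped_gadget_arcs z = gadget_arcs z \<union>
     symcl {(Zv', Ov 1), (Zv', Ov 2), (Zv', Ov 3), (Rv 0, Xv), (Rv 0, Yv), (Rv 0, Orig z)}"

text \<open>Adjacency lists of \<open>capped_gadget_arcs\<close>. The type \<open>unit\<close> makes
  the graph concrete enough for evaluation, \<open>Orig ()\<close> standing for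
  \<open>Orig z\<close>. The last branch for \<open>Rv\<close> is the shrunk copy
  \<open>Rv 0\<close>, the one for \<open>Gv\<close> is \<open>Gv 3\<close>.\<close>

fun gadget_nb :: "unit part_vertex \<Rightarrow> unit part_vertex list" where
  "gadget_nb (Orig _) = [Gv 2, Rv 3, Rv 0]"
| "gadget_nb Xv = [Rv 1, Gv 3, Rv 0]"
| "gadget_nb Yv = [Gv 1, Rv 2, Rv 0]"
| "gadget_nb (Rv j) =
    (if j = 1 then [Xv, Gv 1, Xv']
     else if j = 2 then [Yv, Gv 2, Xv']
     else if j = 3 then [Orig (), Gv 3, Xv']
     else [Xv, Yv, Orig ()])"
| "gadget_nb (Gv j) =
    (if j = 1 then [Yv, Rv 1, Ov 1]
     else if j = 2 then [Orig (), Rv 2, Ov 2]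
     else [Xv, Rv 3, Ov 3])"
| "gadget_nb (Ov j) = [Gv j, Yv', Zv']"
| "gadget_nb Xv' = [Rv 1, Rv 2, Rv 3]"
| "gadget_nb Yv' = [Ov 1, Ov 2, Ov 3]"
| "gadget_nb Zv' = [Ov 1, Ov 2, Ov 3]"

definition gadget_list :: "unit part_vertex list" where
  "gadget_list = [Rv 0, Xv, Yv, Orig (), Rv 1, Rv 2, Rv 3, Gv 1, Gv 2, Gv 3, Xv', Yv', Zv',
     Ov 1, Ov 2, Ov 3]"

lemma gadget_search:
  "connected_without gadget_nb gadget_list []"
  "\<forall>s\<in>set gadget_list. \<forall>t\<in>set gadget_list. connected_without gadget_nb gadget_list [s, t]"
  by code_simp+

lemma sym_gadget_arcs: "sym (gadget_arcs z)"
  unfolding gadget_arcs_def by (rule sym_symcl)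

lemma sym_capped_gadget_arcs: "sym (capped_gadget_arcs z)"
  unfolding capped_gadget_arcs_def by (intro sym_Un sym_gadget_arcs sym_symcl)

lemma tri_connected_capped_gadget:
  "tri_connected (insert Zv' (insert (Rv 0) (gadget_verts z))) (capped_gadget_arcs z)"
proof -
  \<comment> \<open>Renaming \<open>()\<close> to \<open>z\<close> carries the evaluated instance
    over to an arbitrary vertex type.\<close>
  let ?f = "map_part_vertex (\<lambda>_::unit. z)"
  have "(u, w) \<in> capped_gadget_arcs ()" if "u \<in> set gadget_list" "w \<in> set (gadget_nb u)" for u w
    using that unfolding gadget_list_def
    by (simp, elim disjE) (simp_all add: capped_gadget_arcs_def gadget_arcs_def, auto)
  then have "tri_connected (set gadget_list) (capped_gadget_arcs ())"
    by (intro tri_connected_by_search[OF gadget_search sym_capped_gadget_arcs])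
  moreover have "inj ?f" by (rule part_vertex.inj_map) (simp add: inj_on_def)
  ultimately have "tri_connected (?f ` set gadget_list) (map_prod ?f ?f ` capped_gadget_arcs ())"
    by (intro tri_connected_image) (auto intro: inj_on_subset)
  moreover have "?f ` set gadget_list = insert Zv' (insert (Rv 0) (gadget_verts z))"
    by (simp add: gadget_list_def gadget_verts_def insert_commute)
  moreover have "map_prod ?f ?f ` capped_gadget_arcs () = capped_gadget_arcs z"
    by (simp add: capped_gadget_arcs_def gadget_arcs_def)
  ultimately show ?thesis by simp
qed

text \<open>The path from \<open>Ov j\<close> passes through \<open>Yv'\<close> to collect the third
  \<open>Ov\<close>, enters the 9-cycle there, and takes in the whole of it with two edges omitted
  and \<open>Xv'\<close> bridging the gap, before it leaves by \<open>Ov k\<close>.\<close>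

lemma gadget_path:
  assumes "j \<in> {1, 2, 3}" "k \<in> {1, 2, 3}" "j \<noteq> k"
  obtains L where "distinct L" "set L = gadget_verts z"
    "successively (\<lambda>u v. (u, v) \<in> gadget_arcs z) L" "L \<noteq> []" "hd L = Ov j" "last L = Ov k"
proof -
  let ?Q = "\<lambda>j k L. distinct L \<and> set L = gadget_verts z \<and>
    successively (\<lambda>u v. (u, v) \<in> gadget_arcs z) L \<and> L \<noteq> [] \<and> hd L = Ov j \<and> last L = Ov k"
  \<comment> \<open>The next two lists arise from the first by rotating the 9-cycle.\<close>
  have 1: "?Q 3 2 [Ov 3, Yv', Ov 1, Gv 1, Yv, Rv 2, Xv', Rv 1, Xv, Gv 3, Rv 3, Orig z, Gv 2, Ov 2]"
    by (simp add: gadget_verts_def gadget_arcs_def) blast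
  have 2: "?Q 1 3 [Ov 1, Yv', Ov 2, Gv 2, Orig z, Rv 3, Xv', Rv 2, Yv, Gv 1, Rv 1, Xv, Gv 3, Ov 3]"
    by (simp add: gadget_verts_def gadget_arcs_def) blast
  have 3: "?Q 2 1 [Ov 2, Yv', Ov 3, Gv 3, Xv, Rv 1, Xv', Rv 3, Orig z, Gv 2, Rv 2, Yv, Gv 1, Ov 1]"
    by (simp add: gadget_verts_def gadget_arcs_def) blast
  have rev: "?Q k j (rev L)" if "?Q j k L" for j k L
    using that by (auto simp: hd_rev last_rev symD[OF sym_gadget_arcs] elim!: successively_mono)
  \<comment> \<open>The three lists and their reversals account for all six ordered pairs.\<close>
  have "\<exists>L. ?Q j k L"
    using assms 1 2 3 rev[OF 1] rev[OF 2] rev[OF 3]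
    by (elim insertE emptyE; hypsubst) (blast | simp)+
  then show ?thesis using that by blast
qed

locale part =
  fixes H :: "'a pair_pre_digraph" and z :: 'a and n :: "nat \<Rightarrow> 'a"
  assumes cubic: "cubic H"
    and z: "z \<in> pverts H"
    and nb_z: "parcs H `` {z} = {n 1, n 2, n 3}"
begin

sublocale H: pair_graph H using cubic by (simp add: cubic_def)

abbreviation P where "P \<equiv> part_graph H z n"

lemma H_sym: "(u, v) \<in> parcs H \<longleftrightarrow> (v, u) \<in> parcs H"
  using H.arcs_symmetric by blast

lemma arc_z: "(z, v) \<in> parcs H \<longleftrightarrow> v = n 1 \<or> v = n 2 \<or> v = n 3"
  using nb_z by blast

lemma arc_z': "(v, z) \<in> parcs H \<longleftrightarrow> v = n 1 \<or> v = n 2 \<or> v = n 3"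
  using arc_z H_sym by blast

lemma n_neq: "n 1 \<noteq> n 2" "n 1 \<noteq> n 3" "n 2 \<noteq> n 3" "n 2 \<noteq> n 1" "n 3 \<noteq> n 1" "n 3 \<noteq> n 2"
proof -
  have "card (parcs H `` {z}) = 3"
    using cubic z cubic_iff[OF H.pair_graph] by blast
  then have "card {n 1, n 2, n 3} = 3" unfolding nb_z .
  then show "n 1 \<noteq> n 2" "n 1 \<noteq> n 3" "n 2 \<noteq> n 3" "n 2 \<noteq> n 1" "n 3 \<noteq> n 1" "n 3 \<noteq> n 2"
    by (auto simp: card_insert_if split: if_splits)
qed

lemma n_in: "n 1 \<in> pverts H" "n 2 \<in> pverts H" "n 3 \<in> pverts H"
  and n_neq_z: "n 1 \<noteq> z" "n 2 \<noteq> z" "n 3 \<noteq> z" "z \<noteq> n 1" "z \<noteq> n 2" "z \<noteq> n 3"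
  using arc_z H.no_loops' H.wellformed' by blast+

section \<open>Structure of a part and transfer of properties from \<open>H\<close>\<close>

lemma pverts_P: "pverts P = Orig ` (pverts H - {z}) \<union> insert Zv' (gadget_verts z)"
  using z by (auto simp: part_graph_def triangle_graph_def gadget_verts_def)

text \<open>The arcs are sorted by the two cuts: inside \<open>H - z\<close>, across the first cut,
  inside the gadget, and at \<open>Zv'\<close>. The edge from \<open>z\<close> to \<open>n 3\<close>
  is the one edge at \<open>z\<close> that survives, so the third edge of the first cut ends at
  \<open>Orig z\<close> itself.\<close>

lemma parcs_P:
  "parcs P = map_prod Orig Orig ` Restr (parcs H) (- {z}) \<union>
     symcl {(Orig (n 1), Xv), (Orig (n 2), Yv), (Orig (n 3), Orig z)} \<union> gadget_arcs z \<union>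
     symcl {(Zv', Ov 1), (Zv', Ov 2), (Zv', Ov 3)}"
proof -
  have H: "parcs H - symcl {(z, n 1), (z, n 2)} = Restr (parcs H) (- {z}) \<union> {(z, n 3), (n 3, z)}"
    using arc_z arc_z' n_neq n_neq_z by auto
  let ?A = "map_prod Orig Orig ` Restr (parcs H) (- {z})"
  have img: "map_prod Orig Orig ` (parcs H - symcl {(z, n 1), (z, n 2)}) =
      ?A \<union> {(Orig z, Orig (n 3)), (Orig (n 3), Orig z)}"
    unfolding H image_Un by simp
  let ?T = "symcl {(Xv, Yv), (Yv, Orig z), (Orig z, Xv)}"
  have A: "?A - ?T = ?A" by auto
  have T: "{(Orig z, Orig (n 3)), (Orig (n 3), Orig z)} \<union> symcl {(Orig (n 1), Xv), (Xv, Orig z),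
      (Orig (n 2), Yv), (Yv, Orig z), (Xv, Yv)} - ?T =
      symcl {(Orig (n 1), Xv), (Orig (n 2), Yv), (Orig (n 3), Orig z)}"
    using n_neq_z by auto
  have "parcs (triangle_graph H z n) - ?T = ?A - ?T \<union>
      ({(Orig z, Orig (n 3)), (Orig (n 3), Orig z)} \<union> symcl {(Orig (n 1), Xv), (Xv, Orig z),
      (Orig (n 2), Yv), (Yv, Orig z), (Xv, Yv)} - ?T)"
    by (simp only: triangle_graph_def pair_pre_digraph.simps img Un_Diff Un_assoc)
  then have tri: "parcs (triangle_graph H z n) - ?T = ?A \<union>
      symcl {(Orig (n 1), Xv), (Orig (n 2), Yv), (Orig (n 3), Orig z)}"
    unfolding A T .
  have "parcs P = (parcs (triangle_graph H z n) - ?T) \<union>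
      (gadget_arcs z \<union> symcl {(Zv', Ov 1), (Zv', Ov 2), (Zv', Ov 3)})"
    by (simp add: part_graph_def gadget_arcs_def insert_commute)
  then show ?thesis unfolding tri by (simp only: Un_assoc)
qed

lemma sym_P: "sym (parcs P)"
proof -
  have "sym (Restr (parcs H) (- {z}))" using H_sym by (auto simp: sym_def)
  then show ?thesis
    unfolding parcs_P by (intro sym_Un sym_symcl sym_gadget_arcs sym_map_prod_image)
qed

lemma finite_P: "finite (pverts P)"
  unfolding pverts_P gadget_verts_def using H.pair_finite_verts by simp

lemma Orig_arc_iff:
  assumes "u \<noteq> z"
  shows "(Orig u, y) \<in> parcs P \<longleftrightarrow> (\<exists>v. y = Orig v \<and> v \<noteq> z \<and> (u, v) \<in> parcs H) \<or>
    (u = n 1 \<and> y = Xv) \<or> (u = n 2 \<and> y = Yv) \<or> (u = n 3 \<and> y = Orig z)"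
  using assms n_neq_z by (auto simp: parcs_P gadget_arcs_def)

lemma nb_P:
  "parcs P `` {Orig z} = {Orig (n 3), Gv 2, Rv 3}"
  "parcs P `` {Xv} = {Orig (n 1), Rv 1, Gv 3}"
  "parcs P `` {Yv} = {Orig (n 2), Rv 2, Gv 1}"
  "parcs P `` {Rv 1} = {Xv, Gv 1, Xv'}"
  "parcs P `` {Rv 2} = {Yv, Gv 2, Xv'}"
  "parcs P `` {Rv 3} = {Orig z, Gv 3, Xv'}"
  "parcs P `` {Gv 1} = {Rv 1, Yv, Ov 1}"
  "parcs P `` {Gv 2} = {Rv 2, Orig z, Ov 2}"
  "parcs P `` {Gv 3} = {Rv 3, Xv, Ov 3}"
  "parcs P `` {Ov 1} = {Gv 1, Yv', Zv'}"
  "parcs P `` {Ov 2} = {Gv 2, Yv', Zv'}"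
  "parcs P `` {Ov 3} = {Gv 3, Yv', Zv'}"
  "parcs P `` {Xv'} = {Rv 1, Rv 2, Rv 3}"
  "parcs P `` {Yv'} = {Ov 1, Ov 2, Ov 3}"
  "parcs P `` {Zv'} = {Ov 1, Ov 2, Ov 3}"
proof -
  have inner: "(map_prod Orig Orig ` Restr (parcs H) (- {z})) `` {v} = {}"
    if "v \<notin> Orig ` (- {z})" for v :: "'a part_vertex"
    using that by auto
  have ins: "insert (a, b) R `` {v} = (if a = v then insert b (R `` {v}) else R `` {v})"
    for a b v and R :: "'a part_vertex rel"
    by auto
  note facts = parcs_P gadget_arcs_def Un_Image ins inner image_iff n_neq_z insert_commute
  show "parcs P `` {Orig z} = {Orig (n 3), Gv 2, Rv 3}" by (simp add: facts del: One_nat_def)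
  show "parcs P `` {Xv} = {Orig (n 1), Rv 1, Gv 3}" by (simp add: facts del: One_nat_def)
  show "parcs P `` {Yv} = {Orig (n 2), Rv 2, Gv 1}" by (simp add: facts del: One_nat_def)
  show "parcs P `` {Rv 1} = {Xv, Gv 1, Xv'}" by (simp add: facts del: One_nat_def)
  show "parcs P `` {Rv 2} = {Yv, Gv 2, Xv'}" by (simp add: facts del: One_nat_def)
  show "parcs P `` {Rv 3} = {Orig z, Gv 3, Xv'}" by (simp add: facts del: One_nat_def)
  show "parcs P `` {Gv 1} = {Rv 1, Yv, Ov 1}" by (simp add: facts del: One_nat_def)
  show "parcs P `` {Gv 2} = {Rv 2, Orig z, Ov 2}" by (simp add: facts del: One_nat_def)
  show "parcs P `` {Gv 3} = {Rv 3, Xv, Ov 3}" by (simp add: facts del: One_nat_def)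
  show "parcs P `` {Ov 1} = {Gv 1, Yv', Zv'}" by (simp add: facts del: One_nat_def)
  show "parcs P `` {Ov 2} = {Gv 2, Yv', Zv'}" by (simp add: facts del: One_nat_def)
  show "parcs P `` {Ov 3} = {Gv 3, Yv', Zv'}" by (simp add: facts del: One_nat_def)
  show "parcs P `` {Xv'} = {Rv 1, Rv 2, Rv 3}" by (simp add: facts del: One_nat_def)
  show "parcs P `` {Yv'} = {Ov 1, Ov 2, Ov 3}" by (simp add: facts del: One_nat_def)
  show "parcs P `` {Zv'} = {Ov 1, Ov 2, Ov 3}" by (simp add: facts del: One_nat_def)
qed

text \<open>A vertex of the copy keeps its neighbours, except that \<open>z\<close> is exchanged for
  the corner assigned to it. In the form of an image under an injective map this gives the degree at
  once.\<close>

lemma nb_P_Orig: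
  assumes "u \<noteq> z"
  shows "parcs P `` {Orig u} =
    (\<lambda>v. if v \<noteq> z then Orig v else if u = n 1 then Xv else if u = n 2 then Yv else Orig z) `
      (parcs H `` {u})" (is "_ = ?f ` _")
proof (intro set_eqI iffI)
  fix y assume "y \<in> parcs P `` {Orig u}"
  then consider v where "y = Orig v" "v \<noteq> z" "(u, v) \<in> parcs H"
    | "u = n 1" "y = Xv" | "u = n 2" "y = Yv" | "u = n 3" "y = Orig z"
    using Orig_arc_iff[OF assms] by auto
  then show "y \<in> ?f ` (parcs H `` {u})"
  proof cases
    case (1 v)
    then show ?thesis by (intro image_eqI[of _ _ v]) simp_all
  qed (use arc_z' n_neq in \<open>intro image_eqI[of _ _ z]; simp\<close>)+
next
  fix y assume "y \<in> ?f ` (parcs H `` {u})"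
  then obtain v where v: "y = ?f v" "(u, v) \<in> parcs H" by blast
  show "y \<in> parcs P `` {Orig u}"
  proof (cases "v = z")
    case True
    then have "u = n 1 \<or> u = n 2 \<or> u = n 3" using v(2) arc_z' by blast
    then show ?thesis
      using True v(1) n_neq Orig_arc_iff[OF assms] by (elim disjE) simp_all
  qed (use v Orig_arc_iff[OF assms] in simp)
qed

lemma pair_graph_P: "pair_graph P"
proof (rule pair_graphI[OF finite_P _ sym_P])
  have sub: "gadget_arcs z \<subseteq> gadget_verts z \<times> gadget_verts z"
    by (simp add: gadget_arcs_def gadget_verts_def)
  have "symcl {(Orig (n 1), Xv), (Orig (n 2), Yv), (Orig (n 3), Orig z)} \<union>
      symcl {(Zv', Ov 1), (Zv', Ov 2), (Zv', Ov 3)} \<subseteq> pverts P \<times> pverts P"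
    using n_in n_neq_z by (simp add: pverts_P gadget_verts_def)
  moreover have "map_prod Orig Orig ` Restr (parcs H) (- {z}) \<subseteq> pverts P \<times> pverts P"
    using H.wellformed' by (fastforce simp: pverts_P)
  moreover have "gadget_arcs z \<subseteq> pverts P \<times> pverts P" using sub by (auto simp: pverts_P)
  ultimately show "parcs P \<subseteq> pverts P \<times> pverts P" unfolding parcs_P by blast
  show "(v, v) \<notin> parcs P" for v
    using n_neq_z H.no_loops' by (auto simp: parcs_P gadget_arcs_def)
qed

lemma cubic_P: "Defs.cubic P"
  unfolding cubic_iff[OF pair_graph_P]
proof
  fix v assume "v \<in> pverts P"
  then consider u where "v = Orig u" "u \<noteq> z" "u \<in> pverts H" | "v \<in> insert Zv' (gadget_verts z)"
    unfolding pverts_P by auto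
  then show "card (parcs P `` {v}) = 3"
  proof cases
    case (1 u)
    have "card (parcs H `` {u}) = 3"
      using cubic 1 cubic_iff[OF H.pair_graph] by blast
    then show ?thesis
      unfolding 1(1) nb_P_Orig[OF 1(2)] by (subst card_image) (auto simp: inj_on_def)
  next
    case 2
    then show ?thesis
      unfolding gadget_verts_def using n_neq_z by (elim insertE emptyE) (simp_all add: nb_P del: One_nat_def)
  qed
qed

text \<open>\<open>P\<close> is \<open>H\<close> spliced at \<open>z\<close> with the capped gadget
  at \<open>Rv 0\<close>; the neighbours \<open>n 1\<close>, \<open>n 2\<close>, \<open>n 3\<close>
  are joined to \<open>Xv\<close>, \<open>Yv\<close>, \<open>Orig z\<close> in this order.\<close>

lemma tri_connected_P:
  assumes "tri_connected (pverts H) (parcs H)"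
  shows "tri_connected (pverts P) (parcs P)"
proof -
  let ?f = "map_prod Orig Orig :: _ \<Rightarrow> 'a part_vertex \<times> 'a part_vertex"
  let ?W = "insert Zv' (insert (Rv 0) (gadget_verts z))"
  define t :: "nat \<Rightarrow> 'a part_vertex" where "t k = Orig (n k)" for k
  define r :: "nat \<Rightarrow> 'a part_vertex" where
    "r k = (if k = 1 then Xv else if k = 2 then Yv else Orig z)" for k
  have V: "tri_connected (Orig ` pverts H) (?f ` parcs H)"
    by (rule tri_connected_image[OF assms _ H.pair_finite_verts]) (simp add: inj_on_def)
  have symV: "sym (?f ` parcs H)"
    by (rule sym_map_prod_image) (use H_sym in \<open>auto simp: sym_def\<close>)
  have zV: "Orig z \<in> Orig ` pverts H" using z by blast
  have nbV: "(?f ` parcs H) `` {Orig z} \<inter> Orig ` pverts H \<subseteq> {t 1, t 2, t 3}"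
    using arc_z by (auto simp: t_def)
  have nbW: "capped_gadget_arcs z `` {Rv 0} \<inter> ?W \<subseteq> {r 1, r 2, r 3}"
    by (auto simp: capped_gadget_arcs_def gadget_arcs_def r_def)
  have t: "inj_on t {1, 2, 3}" "t ` {1, 2, 3} \<subseteq> Orig ` pverts H - {Orig z}"
    using n_neq n_neq_z n_in by (auto simp: t_def)
  have r: "inj_on r {1, 2, 3}" "r ` {1, 2, 3} \<subseteq> ?W - {Rv 0}"
    by (auto simp: r_def gadget_verts_def)
  have disj: "(Orig ` pverts H - {Orig z}) \<inter> (?W - {Rv 0}) = {}"
    by (auto simp: gadget_verts_def)
  have E1: "Restr (?f ` parcs H) (Orig ` pverts H - {Orig z}) \<subseteq> parcs P"
    unfolding parcs_P by fastforce
  have E2: "Restr (capped_gadget_arcs z) (?W - {Rv 0}) \<subseteq> parcs P"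
    unfolding parcs_P capped_gadget_arcs_def by auto
  have tr: "(t k, r k) \<in> parcs P" if "k \<in> {1, 2, 3}" for k
    using that by (auto simp: parcs_P t_def r_def)
  have "tri_connected (Orig ` pverts H - {Orig z} \<union> (?W - {Rv 0})) (parcs P)"
    by (rule tri_connected_splice[OF V symV zV nbV tri_connected_capped_gadget
          sym_capped_gadget_arcs _ nbW disj t r sym_P E1 E2 tr]) auto
  moreover have "Orig ` pverts H - {Orig z} \<union> (?W - {Rv 0}) = pverts P"
    by (auto simp: pverts_P gadget_verts_def)
  ultimately show ?thesis by simp
qed

lemma hamiltonian_if_path:
  assumes "distinct ys" "set ys = pverts H - {z}" "successively (\<lambda>u v. (u, v) \<in> parcs H) ys"
    and "(z, hd ys) \<in> parcs H" "(z, last ys) \<in> parcs H" "hd ys \<noteq> last ys"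
  shows "hamiltonian (with_proj H)"
proof -
  have "n 1 \<in> set ys" unfolding assms(2) using n_in(1) n_neq_z(1) by simp
  then have ne: "ys \<noteq> []" by force
  \<comment> \<open>Distinct ends mean at least two vertices, so closing the path through
    \<open>z\<close> gives a cycle of length at least 3.\<close>
  moreover have "2 \<le> length ys" using assms(6) ne by (cases ys; cases "tl ys") auto
  moreover have "(last ys, z) \<in> parcs H" using assms(5) H_sym by blast
  moreover have "z \<notin> set ys" using assms(2) by simp
  ultimately have "cyclic (parcs H) (z # ys)"
    using assms(1,3,4)
    by (simp add: cyclic_iff_successively successively_append_iff successively_Cons)
  moreover have "set (z # ys) = pverts H" using assms(2) z by auto
  ultimately show ?thesis unfolding hamiltonian_iff[OF H.pair_wf_digraph] by blast
qed

end

section \<open>The construction\<close>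

locale three_graphs =
  fixes H :: "nat \<Rightarrow> 'a pair_pre_digraph" and z :: "nat \<Rightarrow> 'a" and n :: "nat \<Rightarrow> nat \<Rightarrow> 'a"
    and \<sigma> :: "nat \<Rightarrow> nat \<Rightarrow> nat"
  assumes part: "i \<in> {1, 2, 3} \<Longrightarrow> part (H i) (z i) (n i)"
    and \<sigma>: "i \<in> {1, 2, 3} \<Longrightarrow> bij_betw (\<sigma> i) {1, 2, 3} {1, 2, 3}"
begin

lemma \<sigma>_in: "i \<in> {1, 2, 3} \<Longrightarrow> k \<in> {1, 2, 3} \<Longrightarrow> \<sigma> i k \<in> {1, 2, 3}"
  using \<sigma> bij_betwE by blast

lemma \<sigma>_neq:
  "i \<in> {1, 2, 3} \<Longrightarrow> j \<in> {1, 2, 3} \<Longrightarrow> k \<in> {1, 2, 3} \<Longrightarrow> j \<noteq> k \<Longrightarrow> \<sigma> i j \<noteq> \<sigma> i k"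
  using \<sigma> unfolding bij_betw_def inj_on_def by meson

sublocale three_parts "\<lambda>i. part_graph (H i) (z i) (n i)" Zv' "\<lambda>i k. Ov (\<sigma> i k)"
proof (rule three_parts.intro)
  fix i :: nat assume i: "i \<in> {1, 2, 3}"
  interpret part "H i" "z i" "n i" by (rule part[OF i])
  show "pair_graph P" by (rule pair_graph_P)
  show "Zv' \<in> pverts P" by (simp add: pverts_P)
  have "{Ov (\<sigma> i 1), Ov (\<sigma> i 2), Ov (\<sigma> i 3)} = Ov ` \<sigma> i ` {1, 2, 3}" by simp
  also have "\<dots> = Ov ` {1, 2, 3}" using \<sigma>[OF i] by (simp only: bij_betw_def)
  finally show "parcs P `` {Zv'} = {Ov (\<sigma> i 1), Ov (\<sigma> i 2), Ov (\<sigma> i 3)}"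
    unfolding nb_P image_insert image_empty by (rule sym)
  show "Ov (\<sigma> i 1) \<noteq> Ov (\<sigma> i 2) \<and> Ov (\<sigma> i 1) \<noteq> Ov (\<sigma> i 3) \<and> Ov (\<sigma> i 2) \<noteq> Ov (\<sigma> i 3)"
    using \<sigma>_neq[OF i, of 1 2] \<sigma>_neq[OF i, of 1 3] \<sigma>_neq[OF i, of 2 3] by simp
qed

lemma construction_eq_J: "construction H z n \<sigma> = J"
  by (simp add: construction_def J_def)

section \<open>The copies of \<open>H i\<close> minus \<open>z i\<close> inside the joined
  graph\<close>

definition copy :: "nat \<Rightarrow> 'a part_vertex joined_vertex set" where
  "copy i = Part i ` Orig ` (pverts (H i) - {z i})"

lemma sym_J: "sym (parcs J)"
  unfolding parcs_J by (rule sym_stage_arcs)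

lemma pverts_J_eq: "pverts J = insert Hub (\<Union>i\<in>{1, 2, 3}. copy i \<union> Part i ` gadget_verts (z i))"
proof -
  have "pverts (part_graph (H i) (z i) (n i)) - {Zv'} =
      Orig ` (pverts (H i) - {z i}) \<union> gadget_verts (z i)" if "i \<in> {1, 2, 3}" for i
  proof -
    interpret part "H i" "z i" "n i" by (rule part[OF that])
    show ?thesis unfolding pverts_P by (auto simp: gadget_verts_def)
  qed
  then show ?thesis
    by (simp add: pverts_J stage_verts_def copy_def image_Un)
qed

lemma gadget_arc_J:
  assumes i: "i \<in> {1, 2, 3}" and uv: "(u, v) \<in> gadget_arcs (z i)"
  shows "(Part i u, Part i v) \<in> parcs J"
proof -
  interpret part "H i" "z i" "n i" by (rule part[OF i])
  have "u \<noteq> Zv'" "v \<noteq> Zv'" using uv by (auto simp: gadget_arcs_def)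
  moreover have "(u, v) \<in> parcs P" using uv by (simp add: parcs_P)
  ultimately show ?thesis
    unfolding parcs_J using stage_arcs_inner[OF i] i by blast
qed

lemma copy_arc_iff:
  assumes i: "i \<in> {1, 2, 3}" and u: "u \<noteq> z i"
  shows "(Part i (Orig u), y) \<in> parcs J \<longleftrightarrow>
    (\<exists>v. y = Part i (Orig v) \<and> v \<noteq> z i \<and> (u, v) \<in> parcs (H i)) \<or>
    (u = n i 1 \<and> y = Part i Xv) \<or> (u = n i 2 \<and> y = Part i Yv) \<or>
    (u = n i 3 \<and> y = Part i (Orig (z i)))"
proof -
  interpret part "H i" "z i" "n i" by (rule part[OF i])
  have "(Part i (Orig u), y) \<notin> links {1, 2, 3}"
    by (simp add: links_def port_def)
  then have "(Part i (Orig u), y) \<in> parcs J \<Longrightarrow> \<exists>v. y = Part i v"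
    unfolding parcs_J stage_arcs_def by auto
  moreover have "(Part i (Orig u), Part i v) \<in> parcs J \<longleftrightarrow> (Orig u, v) \<in> parcs P \<and> v \<noteq> Zv'" for v
    unfolding parcs_J using stage_arcs_inner[OF i] i by auto
  ultimately have "(Part i (Orig u), y) \<in> parcs J \<longleftrightarrow>
      (\<exists>v. y = Part i v \<and> (Orig u, v) \<in> parcs P \<and> v \<noteq> Zv')" by blast
  then show ?thesis unfolding Orig_arc_iff[OF u] by auto
qed

lemma endpoint_in_copy:
  assumes i: "i \<in> {1, 2, 3}" and ham: "\<not> hamiltonian (with_proj (H i))"
    and p: "vpath p (with_proj J)" "set p = pverts J"
  shows "hd p \<in> copy i \<or> last p \<in> copy i"
proof (rule ccontr)
  assume ends: "\<not> ?thesis"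
  interpret part "H i" "z i" "n i" by (rule part[OF i])
  define f where "f = (\<lambda>u. Part i (Orig u :: 'a part_vertex))"
  have inj: "inj f" by (simp add: f_def inj_on_def)
  have copy: "copy i = f ` (pverts (H i) - {z i})" by (auto simp: copy_def f_def)
  let ?T = "f ` {n i 1, n i 2, n i 3}"
  \<comment> \<open>The outer ends of the three cut edges; the last branch serves
    \<open>f (n i 3)\<close>.\<close>
  define out where "out y = (if y = f (n i 1) then Part i Xv else if y = f (n i 2) then Part i Yv
    else Part i (Orig (z i)))" for y
  have bd: "a \<in> ?T \<and> b = out a"
    if ab: "a \<in> copy i" "b \<notin> copy i" "(a, b) \<in> parcs J \<or> (b, a) \<in> parcs J" for a b
  proof -
    obtain u where u: "a = Part i (Orig u)" "u \<in> pverts (H i)" "u \<noteq> z i"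
      using ab(1) by (auto simp: copy_def)
    have "(Part i (Orig u), b) \<in> parcs J" using ab(3) sym_J u(1) by (auto dest: symD)
    moreover have "\<not> (\<exists>v. b = Part i (Orig v) \<and> v \<noteq> z i \<and> (u, v) \<in> parcs (H i))"
      using ab(2) H.wellformed' by (auto simp: copy_def)
    ultimately have "(u = n i 1 \<and> b = Part i Xv) \<or> (u = n i 2 \<and> b = Part i Yv) \<or>
        (u = n i 3 \<and> b = Part i (Orig (z i)))"
      using copy_arc_iff[OF i u(3)] by blast
    then show ?thesis using n_neq by (auto simp: u(1) f_def out_def)
  qed
  have cne: "copy i \<noteq> {}" using n_in(1) n_neq_z(1) by (auto simp: copy)
  moreover have "copy i \<subseteq> set p" using i by (auto simp: p(2) pverts_J_eq)
  moreover have "card ?T \<le> 3" by (rule order_trans[OF card_image_le]) (simp_all add: card_insert_if)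
  ultimately obtain ys where ys: "distinct ys" "set ys = copy i"
    "successively (\<lambda>u v. (u, v) \<in> parcs J) ys" "hd ys \<in> ?T" "last ys \<in> ?T" "hd ys \<noteq> last ys"
    using path_inside_three_cut[OF vpath_successively(2,1)[OF p(1)], of "copy i" ?T out] ends bd
    by blast
  \<comment> \<open>The run covering the copy is pulled back along \<open>f\<close> to a path of
    \<open>H i\<close> that spans all vertices but \<open>z i\<close>.\<close>
  have "set ys \<subseteq> range f" using ys(2) by (auto simp: copy)
  then obtain xs where xs: "ys = map f xs" by (metis ex_map_conv image_iff subsetD)
  have ne: "xs \<noteq> []" using ys(2) cne xs by auto
  have "set xs = pverts (H i) - {z i}"
    using ys(2) inj by (simp add: xs copy inj_image_eq_iff)
  moreover have "distinct xs" using ys(1) by (simp add: xs distinct_map)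
  moreover have "successively (\<lambda>u v. (u, v) \<in> parcs (H i)) xs"
  proof -
    have "successively (\<lambda>u v. (f u, f v) \<in> parcs J) xs"
      using ys(3) by (simp add: xs successively_map)
    then show ?thesis
    proof (rule successively_mono)
      fix u v assume "u \<in> set xs" "v \<in> set xs" "(f u, f v) \<in> parcs J"
      then show "(u, v) \<in> parcs (H i)"
        using copy_arc_iff[OF i, of u] calculation(1) by (auto simp: f_def)
    qed
  qed
  moreover have "hd xs \<noteq> last xs"
    using ys(6) ne by (auto simp: xs hd_map last_map)
  moreover have "(z i, hd xs) \<in> parcs (H i)" "(z i, last xs) \<in> parcs (H i)"
    using ys(4,5) ne inj arc_z by (auto simp: xs hd_map last_map inj_eq)
  ultimately show False using hamiltonian_if_path ham by blast
qed

lemma not_traceable_J: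
  assumes "\<And>i. i \<in> {1, 2, 3} \<Longrightarrow> \<not> hamiltonian (with_proj (H i))"
  shows "\<not> traceable (with_proj J)"
proof
  assume "traceable (with_proj J)"
  then obtain p where "vpath p (with_proj J)" "set p = pverts J" by (auto simp: traceable_def)
  then have ends: "hd p \<in> copy i \<or> last p \<in> copy i" if "i \<in> {1, 2, 3}" for i
    using endpoint_in_copy assms that by blast
  have "copy 1 \<inter> copy 2 = {}" "copy 1 \<inter> copy 3 = {}" "copy 2 \<inter> copy 3 = {}"
    by (auto simp: copy_def)
  moreover have "hd p \<in> copy 1 \<or> last p \<in> copy 1" "hd p \<in> copy 2 \<or> last p \<in> copy 2"
    "hd p \<in> copy 3 \<or> last p \<in> copy 3"
    by (rule ends, simp)+
  ultimately show False by blast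
qed

lemma star_like_J:
  assumes conn: "Digraph_Component.connected (with_proj J)"
    and cyc: "\<And>i. i \<in> {1, 2, 3} \<Longrightarrow> hamiltonian (pre_digraph.del_vert (with_proj (H i)) (z i))"
  shows "star_like J"
proof -
  have "\<exists>vs. cyclic (Restr (parcs (H i)) (- {z i})) vs \<and> set vs = pverts (H i) - {z i}"
    if "i \<in> {1, 2, 3}" for i
  proof -
    interpret part "H i" "z i" "n i" by (rule part[OF that])
    show ?thesis using cyc[OF that] hamiltonian_del_vert_iff[OF H.pair_wf_digraph] by blast
  qed
  then obtain vs where vs: "cyclic (Restr (parcs (H i)) (- {z i})) (vs i)"
    "set (vs i) = pverts (H i) - {z i}" if "i \<in> {1, 2, 3}" for i
    by metis
  define leaf where "leaf i = map (\<lambda>u. Part i (Orig u :: 'a part_vertex)) (vs i)" for i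
  have set_leaf: "set (leaf i) = copy i" if "i \<in> {1, 2, 3}" for i
    using vs(2)[OF that] by (auto simp: leaf_def copy_def)
  have cyc_leaf: "cyclic (parcs J) (leaf i)" if i: "i \<in> {1, 2, 3}" for i
  proof -
    have "(Part i (Orig u), Part i (Orig v)) \<in> parcs J"
      if "(u, v) \<in> set (zip (vs i) (rotate1 (vs i)))" for u v
    proof -
      have "(u, v) \<in> Restr (parcs (H i)) (- {z i})"
        using that vs(1)[OF i] by (auto simp: cyclic_def)
      then show ?thesis using copy_arc_iff[OF i, of u] by auto
    qed
    moreover have "rotate1 (leaf i) = map (\<lambda>u. Part i (Orig u)) (rotate1 (vs i))"
      by (simp add: leaf_def rotate1_map)
    ultimately show ?thesis
      using vs(1)[OF i] by (auto simp: cyclic_def leaf_def zip_map_map distinct_map inj_on_def)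
  qed
  have path: "\<exists>L. distinct L \<and> set L = gadget_verts (z i) \<and>
      successively (\<lambda>u v. (u, v) \<in> gadget_arcs (z i)) L \<and> L \<noteq> [] \<and>
      hd L = Ov (\<sigma> i j) \<and> last L = Ov (\<sigma> i k)"
    if "i \<in> {1, 2, 3}" "j \<in> {1, 2, 3}" "k \<in> {1, 2, 3}" "j \<noteq> k" for i j k
    using gadget_path[OF \<sigma>_in[OF that(1,2)] \<sigma>_in[OF that(1,3)] \<sigma>_neq[OF that]] by metis
  \<comment> \<open>The ends follow the outer edges in the order hub, a1 to b1, c2 to b2, c3 to a3,
    hub.\<close>
  obtain L1 where L1: "distinct L1" "set L1 = gadget_verts (z 1)"
    "successively (\<lambda>u v. (u, v) \<in> gadget_arcs (z 1)) L1" "L1 \<noteq> []"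
    "hd L1 = Ov (\<sigma> 1 1)" "last L1 = Ov (\<sigma> 1 2)"
    using path[of 1 1 2] by auto
  obtain L2 where L2: "distinct L2" "set L2 = gadget_verts (z 2)"
    "successively (\<lambda>u v. (u, v) \<in> gadget_arcs (z 2)) L2" "L2 \<noteq> []"
    "hd L2 = Ov (\<sigma> 2 3)" "last L2 = Ov (\<sigma> 2 2)"
    using path[of 2 3 2] by auto
  obtain L3 where L3: "distinct L3" "set L3 = gadget_verts (z 3)"
    "successively (\<lambda>u v. (u, v) \<in> gadget_arcs (z 3)) L3" "L3 \<noteq> []"
    "hd L3 = Ov (\<sigma> 3 3)" "last L3 = Ov (\<sigma> 3 1)"
    using path[of 3 3 1] by auto
  \<comment> \<open>The centre: it lifts the Hamiltonian cycle of \<open>K\<^sub>4\<close> through the hub and parts 1, 2, 3.\<close>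
  define d where "d = Hub # map (Part 1) L1 @ map (Part 2) L2 @ map (Part 3) L3"
  have set_d: "set d = insert Hub (\<Union>i\<in>{1, 2, 3}. Part i ` gadget_verts (z i))"
    using L1(2) L2(2) L3(2) by (simp add: d_def Un_assoc)
  have succ: "successively (\<lambda>u v. (u, v) \<in> parcs J) (map (Part i) L)"
    if "i \<in> {1, 2, 3}" "successively (\<lambda>u v. (u, v) \<in> gadget_arcs (z i)) L" for i L
    using that(2) gadget_arc_J[OF that(1)] by (auto simp: successively_map elim: successively_mono)
  have links: "links {1, 2, 3} \<subseteq> parcs J" by (simp add: parcs_J stage_arcs_def)
  have "(Hub, Part 1 (Ov (\<sigma> 1 1))) \<in> parcs J"
    "(Part 1 (Ov (\<sigma> 1 2)), Part 2 (Ov (\<sigma> 2 3))) \<in> parcs J"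
    "(Part 2 (Ov (\<sigma> 2 2)), Part 3 (Ov (\<sigma> 3 3))) \<in> parcs J"
    "(Part 3 (Ov (\<sigma> 3 1)), Hub) \<in> parcs J"
    by (rule subsetD[OF links], simp add: links_def port_def)+
  moreover have "0 < length L1" "0 < length L2" "0 < length L3" using L1(4) L2(4) L3(4) by simp_all
  then have "3 \<le> length d" by (simp add: d_def del: length_greater_0_conv)
  ultimately have cyc_d: "cyclic (parcs J) d"
    unfolding cyclic_iff_successively
    using L1 L2 L3 succ[of 1 L1] succ[of 2 L2] succ[of 3 L3]
    by (auto simp: d_def successively_Cons successively_append_iff hd_map last_map distinct_map
        inj_on_def hd_append Suc_le_eq)
  show ?thesis
  proof (rule star_likeI[OF _ conn cyc_d, of "leaf ` {1, 2, 3}"])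
    show "cubic J"
    proof (rule cubic_J)
      fix i :: nat assume "i \<in> {1, 2, 3}"
      then interpret part "H i" "z i" "n i" by (rule part)
      show "cubic (part_graph (H i) (z i) (n i))" by (rule cubic_P)
    qed
    have disj_leaf: "copy i \<inter> copy j = {}" if "i \<noteq> j" for i j using that by (auto simp: copy_def)
    have disj_d: "set d \<inter> copy i = {}" for i
      by (auto simp: set_d copy_def gadget_verts_def)
    show "set xs \<inter> set ys = {}"
      if xy: "xs \<in> insert d (leaf ` {1, 2, 3})" "ys \<in> insert d (leaf ` {1, 2, 3})" "xs \<noteq> ys" for xs ys
    proof -
      have leaf_d: "set d \<inter> set (leaf i) = {}" if "i \<in> {1, 2, 3}" for i
        using disj_d set_leaf[OF that] by simp
      show ?thesis
      proof (cases "xs = d \<or> ys = d")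
        case True
        then show ?thesis using xy leaf_d by (metis Int_commute imageE insertE)
      next
        case False
        then obtain i j where "i \<in> {1, 2, 3}" "xs = leaf i" "j \<in> {1, 2, 3}" "ys = leaf j"
          using xy(1,2) by (metis imageE insertE)
        moreover from this have "i \<noteq> j" using xy(3) by metis
        ultimately show ?thesis using disj_leaf set_leaf by simp
      qed
    qed
    show "pverts J = (\<Union>vs\<in>insert d (leaf ` {1, 2, 3}). set vs)"
      using set_leaf by (auto simp: set_d pverts_J_eq)
    show "d \<notin> leaf ` {1, 2, 3}"
    proof
      assume "d \<in> leaf ` {1, 2, 3}"
      then have "set d \<subseteq> set d \<inter> copy 1 \<union> set d \<inter> copy 2 \<union> set d \<inter> copy 3"
        using set_leaf by auto
      then show False unfolding disj_d by (simp add: d_def)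
    qed
    fix c assume "c \<in> leaf ` {1, 2, 3}"
    then obtain i where i: "i \<in> {1, 2, 3}" "c = leaf i" by blast
    interpret part "H i" "z i" "n i" by (rule part[OF i(1)])
    show "cyclic (parcs J) c" using cyc_leaf i by blast
    \<comment> \<open>Each of the three edges leaving the copy ends in the gadget and hence on the
      centre; this is one of them.\<close>
    have "(Part i (Orig (n i 3)), Part i (Orig (z i))) \<in> parcs J"
      using copy_arc_iff[OF i(1) n_neq_z(3)] by blast
    then have "(Part i (Orig (z i)), Part i (Orig (n i 3))) \<in> parcs J" using symD[OF sym_J] by blast
    moreover have "Part i (Orig (z i)) \<in> set d" using i(1) by (auto simp: set_d gadget_verts_def)
    moreover have "Part i (Orig (n i 3)) \<in> set c"
      using n_in(3) n_neq_z(3) unfolding i(2) set_leaf[OF i(1)] copy_def by blast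
    ultimately show "\<exists>u\<in>set d. \<exists>v\<in>set c. (u, v) \<in> parcs J" by blast
    fix c' u v assume c': "c' \<in> leaf ` {1, 2, 3}" "c \<noteq> c'" "u \<in> set c" "v \<in> set c'"
    from c'(1) obtain j where j: "c' = leaf j" "j \<in> {1, 2, 3}" by (rule imageE)
    have ji: "j \<noteq> i" using c'(2) i(2) j(1) by metis
    obtain x where x: "u = Part i (Orig x)" "x \<noteq> z i"
      using c'(3) unfolding i(2) set_leaf[OF i(1)] copy_def by blast
    \<comment> \<open>All neighbours of a vertex in a copy belong to the same part, so vertices of
      different leaves are never adjacent.\<close>
    have "v \<in> range (Part j)" using c'(4) unfolding j(1) set_leaf[OF j(2)] copy_def by blast
    then show "(u, v) \<notin> parcs J" using copy_arc_iff[OF i(1) x(2)] ji unfolding x(1) by auto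
  qed
qed

end

theorem theorem2:
  fixes H :: "nat \<Rightarrow> 'a pair_pre_digraph"
    and z :: "nat \<Rightarrow> 'a"
    and n :: "nat \<Rightarrow> nat \<Rightarrow> 'a"
    and \<sigma> :: "nat \<Rightarrow> nat \<Rightarrow> nat"
    and G :: "'a part_vertex joined_vertex pair_pre_digraph"
  assumes "\<And>i. i \<in> {1, 2, 3} \<Longrightarrow> pair_graph (H i)"
    and "\<And>i. i \<in> {1, 2, 3} \<Longrightarrow> k_connected 3 (with_proj (H i))"
    and "\<And>i. i \<in> {1, 2, 3} \<Longrightarrow> cubic (H i)"
    and "\<And>i. i \<in> {1, 2, 3} \<Longrightarrow> \<not> planar (H i)"
    and "\<And>i. i \<in> {1, 2, 3} \<Longrightarrow> hypohamiltonian (with_proj (H i))"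
    and "\<And>i. i \<in> {1, 2, 3} \<Longrightarrow> z i \<in> pverts (H i)"
    and "\<And>i. i \<in> {1, 2, 3} \<Longrightarrow> {w. (z i, w) \<in> parcs (H i)} = {n i 1, n i 2, n i 3}"
    and "\<And>i. i \<in> {1, 2, 3} \<Longrightarrow> bij_betw (\<sigma> i) {1, 2, 3} {1, 2, 3}"
    and "G = construction H z n \<sigma>"
  shows "cubic G \<and> \<not> traceable (with_proj G) \<and> star_like G \<and> k_connected 3 (with_proj G)"
proof -
  interpret three_graphs H z n \<sigma>
  proof (rule three_graphs.intro)
    fix i :: nat assume i: "i \<in> {1, 2, 3}"
    show "part (H i) (z i) (n i)"
    proof (rule part.intro)
      show "parcs (H i) `` {z i} = {n i 1, n i 2, n i 3}"
        using assms(7)[OF i] by (simp add: Image_singleton)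
    qed (rule assms(3,6)[OF i])+
  qed (rule assms(8))
  have G: "G = J" using assms(9) construction_eq_J by simp
  have "3 < card (pverts J)"
  proof -
    have "{Hub, Part 1 Xv, Part 1 Yv, Part 1 Xv'} \<subseteq> pverts J"
      by (simp add: pverts_J_eq gadget_verts_def)
    then have "card {Hub, Part 1 Xv, Part 1 Yv, Part 1 (Xv' :: 'a part_vertex)} \<le> card (pverts J)"
      by (rule card_mono[OF finite_J])
    then show ?thesis by simp
  qed
  moreover have "tri_connected (pverts J) (parcs J)"
  proof (rule tri_connected_J)
    fix i :: nat assume i: "i \<in> {1, 2, 3}"
    interpret part "H i" "z i" "n i" by (rule part[OF i])
    have "tri_connected (pverts (H i)) (parcs (H i))"
      using k_connected_3_iff[OF H.pair_finite_verts] H_sym assms(2)[OF i] by (auto simp: sym_def)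
    then show "tri_connected (pverts P) (parcs P)" by (rule tri_connected_P)
  qed
  ultimately have conn: "k_connected 3 (with_proj J)"
    using k_connected_3_iff[OF finite_J sym_J] by blast
  have "star_like J"
    by (rule star_like_J[OF connected_if_k_connected[OF pair_graph_J conn]])
      (use assms(5,6) in \<open>auto simp: hypohamiltonian_def\<close>)
  moreover have "\<not> traceable (with_proj J)"
    by (rule not_traceable_J) (use assms(5) in \<open>auto simp: hypohamiltonian_def\<close>)
  ultimately show ?thesis unfolding G using conn by (simp add: star_like_def)
qed

end
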